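(* Let $x_A,x_B\sim\mathcal{N}(0,I_p)$, $u_A,u_B\sim\mathcal{N}(0,1)$ (errors independent of the designs), and suppose the null hypothesis $\beta_A=\beta_B$ holds with $\beta_A=\beta_B=\mathbf{1}_p\,c/\sqrt n$, where $c\in\mathbb{R}$ is a constant and $\mathbf{1}_p$ is the vector of ones. Consider the de-biased estimators $\tilde\beta_k$, $k\in\{A,B\}$, built from the scaled Lasso with $\lambda=\lambda_0\sqrt{n^{-1}\log p}$ for a constant $\lambda_0>\sqrt2$, and let $M_n$ and $m_\alpha$ be the test statistic and critical value defined in the context, with $\alpha\in(0,1)$. Then, in the high-dimensional setting $p\gg n$, as $n\to\infty$, $$\mathbb{P}(M_n>m_\alpha)=M(\alpha,c)+o(1),$$ where $$M(\alpha,c)=\mathbb{E}\Big[1-F\big(F^{-1}(1-\alpha,0,\hat\Sigma_A,\hat\Sigma_B),\,c,\,\hat\Sigma_A,\hat\Sigma_B\big)\Big].$$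
   Context: Data: two independent i.i.d. samples $\{(x_{k,i},y_{k,i})\}_{i=1}^n$, $k\in\{A,B\}$, with $y_{k,i}=x_{k,i}^\top\beta_k+u_{k,i}$, $x_{k,i}\in\mathbb{R}^p$. The dimension $p=p_n$ grows with $p/n\to\infty$. $\hat\Sigma_k=n^{-1}\sum_{i=1}^nx_{k,i}x_{k,i}^\top$. Scaled Lasso: $(\hat\beta_k,\hat\sigma_k)$ minimizes $\frac{\sum_{i=1}^n(y_{k,i}-x_{k,i}^\top\beta)^2}{2n\sigma}+\frac{\sigma}{2}+\lambda\|\beta\|_1$ over $(\beta,\sigma)$. "Oracle" de-biased estimator: $\tilde\beta_k=\hat\beta_k+n^{-1}\sum_{i=1}^nx_{k,i}(y_{k,i}-x_{k,i}^\top\hat\beta_k)$. For $x\in\mathbb{R}$ and covariance matrices $\Sigma_A,\Sigma_B$, $F(x,c,\Sigma_A,\Sigma_B)=\mathbb{P}\big(\max_{1\le j\le p}|\zeta_j|/\sqrt{\Sigma_{A,j,j}+\Sigma_{B,j,j}}\le x\big)$, where $\zeta$ is Gaussian in $\mathbb{R}^p$ with mean $(\Sigma_A-\Sigma_B)\mathbf{1}_pc$ and covariance $\Sigma_A+\Sigma_B$; $F^{-1}(\cdot,c,\Sigma_A,\Sigma_B)$ is the inverse in the first argument. Test statistic: $M_n=\max_{1\le j\le p}\sqrt n\,|\tilde\beta_{A,j}-\tilde\beta_{B,j}|/\sqrt{\hat\Sigma_{A,j,j}+\hat\Sigma_{B,j,j}}$. Critical value: $m_\alpha=F^{-1}(1-\alpha,0,\hat\Sigma_A,\hat\Sigma_B)$.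 *)

theory Defs
  imports "HOL-Probability.Probability"
begin

text \<open>
  Vectors in \<open>\<real>\<^sup>p\<close> are functions on \<open>nat\<close> of which only the coordinates \<open>j < p\<close> are used;
  as random vectors they take values in the product space \<open>vec_space p\<close>.
  \<open>p \<times> p\<close> and \<open>n \<times> p\<close> matrices are functions of two indices.
\<close>

datatype population = PopA | PopB

abbreviation vec_space :: "nat \<Rightarrow> (nat \<Rightarrow> real) measure" where
  "vec_space p \<equiv> (\<Pi>\<^sub>M j\<in>{..<p}. borel)"


text \<open>Independence of two random variables whose value spaces may have different types,
  which \<open>prob_space.indep_var\<close> does not allow.\<close>

definition indep_rv ::
    "'w measure \<Rightarrow> 'a measure \<Rightarrow> ('w \<Rightarrow> 'a) \<Rightarrow> 'b measure \<Rightarrow> ('w \<Rightarrow> 'b) \<Rightarrow> bool" where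
  "indep_rv M S X T Y \<longleftrightarrow>
     X \<in> measurable M S \<and> Y \<in> measurable M T \<and>
     prob_space.indep_set M
       {X -` A \<inter> space M | A. A \<in> sets S} {Y -` B \<inter> space M | B. B \<in> sets T}"


section \<open>Gaussian vectors with a possibly singular covariance matrix\<close>

definition normal_law :: "real \<Rightarrow> real \<Rightarrow> real measure" where
  "normal_law m v =
     (if v = 0 then return borel m else density lborel (normal_density m (sqrt v)))"

text \<open>
  \<open>N\<close> is the law of a Gaussian vector with mean \<open>\<mu>\<close> and covariance \<open>S\<close> (symmetric, positive
  semidefinite): every linear form \<open>a\<^sup>T z\<close> is normal with mean \<open>a\<^sup>T \<mu>\<close> and variance \<open>a\<^sup>T S a\<close>,
  a point mass if that variance vanishes.  Singularity matters, since the sample covariance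
  matrices below have rank at most \<open>n < p\<close> and there is no density.
\<close>

definition is_gaussian ::
    "nat \<Rightarrow> (nat \<Rightarrow> real) \<Rightarrow> (nat \<Rightarrow> nat \<Rightarrow> real) \<Rightarrow> (nat \<Rightarrow> real) measure \<Rightarrow> bool" where
  "is_gaussian p \<mu> S N \<longleftrightarrow>
     prob_space N \<and> sets N = sets (vec_space p) \<and>
     (\<forall>a. distr N borel (\<lambda>z. \<Sum>j<p. a j * z j) =
          normal_law (\<Sum>j<p. a j * \<mu> j) (\<Sum>j<p. \<Sum>l<p. a j * S j l * a l))"

text \<open>For a covariance matrix \<open>S\<close> this law exists, and by Cramer-Wold it is unique.\<close>

definition gaussian :: "nat \<Rightarrow> (nat \<Rightarrow> real) \<Rightarrow> (nat \<Rightarrow> nat \<Rightarrow> real) \<Rightarrow> (nat \<Rightarrow> real) measure" where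
  "gaussian p \<mu> S = (THE N. is_gaussian p \<mu> S N)"


section \<open>Law of the maximum\<close>

definition F_max ::
    "nat \<Rightarrow> real \<Rightarrow> real \<Rightarrow> (nat \<Rightarrow> nat \<Rightarrow> real) \<Rightarrow> (nat \<Rightarrow> nat \<Rightarrow> real) \<Rightarrow> real" where
  "F_max p x c SA SB =
     \<P>(z in gaussian p (\<lambda>j. (\<Sum>l<p. SA j l - SB j l) * c) (\<lambda>j l. SA j l + SB j l).
        (MAX j\<in>{..<p}. \<bar>z j\<bar> / sqrt (SA j j + SB j j)) \<le> x)"

text \<open>
  If \<open>SA\<close>, \<open>SB\<close> are covariance matrices, \<open>p > 0\<close>, and \<open>SA + SB\<close> has a positive diagonal, then each
  \<open>q\<close> strictly between \<open>0\<close> and \<open>1\<close> has exactly one preimage under \<open>\<lambda>x. F_max p x c SA SB\<close>, so the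
  choice made by \<open>inv\<close> is immaterial.
\<close>

definition F_max_inv ::
    "nat \<Rightarrow> real \<Rightarrow> real \<Rightarrow> (nat \<Rightarrow> nat \<Rightarrow> real) \<Rightarrow> (nat \<Rightarrow> nat \<Rightarrow> real) \<Rightarrow> real" where
  "F_max_inv p q c SA SB = inv (\<lambda>x. F_max p x c SA SB) q"


section \<open>Estimators and test statistic\<close>

definition sample_cov :: "nat \<Rightarrow> (nat \<Rightarrow> nat \<Rightarrow> real) \<Rightarrow> nat \<Rightarrow> nat \<Rightarrow> real" where
  "sample_cov n X j l = (\<Sum>i<n. X i j * X i l) / real n"

definition residual :: "nat \<Rightarrow> (nat \<Rightarrow> nat \<Rightarrow> real) \<Rightarrow> (nat \<Rightarrow> real) \<Rightarrow> (nat \<Rightarrow> real) \<Rightarrow> nat \<Rightarrow> real" where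
  "residual p X y b i = y i - (\<Sum>j<p. X i j * b j)"

definition scaled_lasso_loss ::
    "nat \<Rightarrow> nat \<Rightarrow> real \<Rightarrow> (nat \<Rightarrow> nat \<Rightarrow> real) \<Rightarrow> (nat \<Rightarrow> real) \<Rightarrow> (nat \<Rightarrow> real) \<Rightarrow> real \<Rightarrow> real" where
  "scaled_lasso_loss n p lam X y b s =
     (\<Sum>i<n. (residual p X y b i)\<^sup>2) / (2 * real n * s) + s / 2 + lam * (\<Sum>j<p. \<bar>b j\<bar>)"

text \<open>
  The scale \<open>s\<close> is positive, except that \<open>s = 0\<close> is admitted for an exact fit, where the loss
  (with \<open>0 / 0 = 0\<close>) has the value \<open>lam * (\<Sum>j<p. \<bar>b j\<bar>)\<close>, its limit as \<open>s\<close> tends to \<open>0\<close>.  When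
  \<open>p > n\<close> the infimum over \<open>s > 0\<close> fails to be attained with positive probability; with this
  closure of the domain a minimizer always exists.
\<close>

definition scaled_lasso_dom ::
    "nat \<Rightarrow> nat \<Rightarrow> (nat \<Rightarrow> nat \<Rightarrow> real) \<Rightarrow> (nat \<Rightarrow> real) \<Rightarrow> ((nat \<Rightarrow> real) \<times> real) set" where
  "scaled_lasso_dom n p X y = {(b, s). s > 0 \<or> s = 0 \<and> (\<forall>i<n. residual p X y b i = 0)}"

definition is_scaled_lasso ::
    "nat \<Rightarrow> nat \<Rightarrow> real \<Rightarrow> (nat \<Rightarrow> nat \<Rightarrow> real) \<Rightarrow> (nat \<Rightarrow> real) \<Rightarrow> (nat \<Rightarrow> real) \<Rightarrow> real \<Rightarrow> bool" where
  "is_scaled_lasso n p lam X y b s \<longleftrightarrow>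
     (b, s) \<in> scaled_lasso_dom n p X y \<and>
     (\<forall>(b', s') \<in> scaled_lasso_dom n p X y.
        scaled_lasso_loss n p lam X y b s \<le> scaled_lasso_loss n p lam X y b' s')"

definition debiased ::
    "nat \<Rightarrow> nat \<Rightarrow> (nat \<Rightarrow> nat \<Rightarrow> real) \<Rightarrow> (nat \<Rightarrow> real) \<Rightarrow> (nat \<Rightarrow> real) \<Rightarrow> nat \<Rightarrow> real" where
  "debiased n p X y b j = b j + (\<Sum>i<n. X i j * residual p X y b i) / real n"

definition test_stat ::
    "nat \<Rightarrow> nat \<Rightarrow> (population \<Rightarrow> nat \<Rightarrow> nat \<Rightarrow> real) \<Rightarrow> (population \<Rightarrow> nat \<Rightarrow> real) \<Rightarrow>
     (population \<Rightarrow> nat \<Rightarrow> real) \<Rightarrow> real" where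
  "test_stat n p X y b =
     (MAX j\<in>{..<p}.
        sqrt (real n) *
        \<bar>debiased n p (X PopA) (y PopA) (b PopA) j - debiased n p (X PopB) (y PopB) (b PopB) j\<bar> /
        sqrt (sample_cov n (X PopA) j j + sample_cov n (X PopB) j j))"

definition crit_value ::
    "nat \<Rightarrow> nat \<Rightarrow> (population \<Rightarrow> nat \<Rightarrow> nat \<Rightarrow> real) \<Rightarrow> real \<Rightarrow> real" where
  "crit_value n p X \<alpha> =
     F_max_inv p (1 - \<alpha>) 0 (sample_cov n (X PopA)) (sample_cov n (X PopB))"

end

theory Submission
  imports Defs "HOL-Real_Asymp.Real_Asymp"
begin

text \<open>
  With probability tending to one both scaled Lasso estimates are zero.  Under the null hypothesis
  the responses \<open>y\<^bsub>k,i\<^esub>\<close> have variance \<open>v = 1 + c\<^sup>2 p / n\<close>, while the covariance of a single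
  regressor with the response is only \<open>c / sqrt n\<close>, so the correlation \<open>\<rho>\<close> satisfies
  \<open>\<bar>\<rho>\<bar> \<le> \<bar>c\<bar> / sqrt n\<close>: the signal is dense, each coordinate of it is invisible, and all of it passes
  for noise.  Writing a regressor as \<open>\<rho> Y + sqrt (1 - \<rho>\<^sup>2) W\<close> with \<open>Y = y / sqrt v\<close> and \<open>W\<close> independent
  of \<open>Y\<close>, its inner product with \<open>y / \<parallel>y\<parallel>\<close> is \<open>\<rho> \<parallel>Y\<parallel>\<close> plus a normal variable of variance at most one.
  The first term is of smaller order than \<open>sqrt (ln p)\<close>, and the largest of the \<open>p\<close> normal variables
  stays below \<open>lam0 * sqrt (ln p)\<close> because \<open>lam0 > sqrt 2\<close> (\<open>large_correlation_bound\<close>,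
  \<open>gaussian_union_bound_asymptotics\<close>).  As soon as all these inner products are
  below \<open>lam0 * sqrt (ln p)\<close>, zero is the only minimizer of the scaled Lasso (\<open>scaled_lasso_zero\<close>).

  When both estimates are zero the test statistic is, given the designs, the maximum of
  \<open>\<bar>\<zeta>\<^sub>j\<bar> / sqrt (\<Sigma>\<^bsub>A,j,j\<^esub> + \<Sigma>\<^bsub>B,j,j\<^esub>)\<close> for a Gaussian vector \<open>\<zeta>\<close> with exactly the mean and covariance that
  occur in \<open>F_max\<close>; here \<open>\<Sigma>\<^sub>A\<close> and \<open>\<Sigma>\<^sub>B\<close> are the sample covariance matrices.  The critical value depends
  on the designs alone, so conditioning on the designs gives an identity for every \<open>n\<close>
  (\<open>rejection_probability_zero_fit\<close>), and the rejection probability of \<open>M\<^sub>n\<close> differs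
  from its claimed approximation by at most the probability that one of the estimates is not zero
  (\<open>rejection_probability_error\<close>).

  Gaussian laws are given through their linear forms.  What turns this into information about joint
  laws is the uniqueness theorem for characteristic functions in several dimensions
  (\<open>PiM_char_unique\<close>).  It shows that \<open>gaussian p \<mu> S\<close> is the image of a standard Gaussian measure
  under an affine map, and that all entries of the designs and all errors
  together are independent standard normal variables (\<open>distr_observations\<close>).  Measurability of the
  critical value in the designs requires that the quantile is unique
  (\<open>max_form_quantile\<close>).
\<close>

section \<open>Uniqueness of characteristic functions in several dimensions\<close>

text \<open>
  The one-dimensional uniqueness theorem of Levy, for the image under \<open>Z\<close> of the finite measure with
  density \<open>g\<close>; after normalization this is a probability measure unless its mass is zero.
\<close>

lemma weighted_char_unique:
  fixes Z g :: "'a \<Rightarrow> real"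
  assumes "prob_space M" "prob_space N"
    and Z [measurable]: "Z \<in> borel_measurable M" "Z \<in> borel_measurable N"
    and g [measurable]: "g \<in> borel_measurable M" "g \<in> borel_measurable N"
    and g0: "\<And>z. 0 \<le> g z" and gC: "\<And>z. g z \<le> C"
    and eq: "\<And>t. (\<integral>z. g z *\<^sub>R iexp (t * Z z) \<partial>M) = (\<integral>z. g z *\<^sub>R iexp (t * Z z) \<partial>N)"
    and B [measurable]: "B \<in> sets borel"
  shows "(\<integral>z. g z * indicator B (Z z) \<partial>M) = (\<integral>z. g z * indicator B (Z z) \<partial>N)"
proof -
  interpret M: prob_space M by fact
  interpret N: prob_space N by fact
  define c where "c = (\<integral>z. g z \<partial>M)"
  have int_gM: "integrable M g"
    by (rule M.integrable_const_bound[where B=C]) (auto simp: g0 gC)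
  have int_gN: "integrable N g"
    by (rule N.integrable_const_bound[where B=C]) (auto simp: g0 gC)
  have cN: "(\<integral>z. g z \<partial>N) = c"
    using eq[of 0] by (simp add: c_def scaleR_conv_of_real)
  have c0: "0 \<le> c"
    unfolding c_def by (simp add: g0)
  have mass: "(\<integral>z. g z * indicator B (Z z) \<partial>K) = c * measure (distr (density K (\<lambda>z. g z / c)) borel Z) B
      \<and> real_distribution (distr (density K (\<lambda>z. g z / c)) borel Z)
      \<and> (\<forall>t. char (distr (density K (\<lambda>z. g z / c)) borel Z) t = (1 / c) *\<^sub>R (\<integral>z. g z *\<^sub>R iexp (t * Z z) \<partial>K))"
    if cpos: "c > 0" and "prob_space K" and Zm [measurable]: "Z \<in> borel_measurable K"
      and gm [measurable]: "g \<in> borel_measurable K"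
      and ig: "integrable K g" and cK: "(\<integral>z. g z \<partial>K) = c" for K
  proof -
    interpret K: prob_space K by fact
    let ?D = "density K (\<lambda>z. g z / c)"
    have "emeasure ?D (space ?D) = (\<integral>\<^sup>+z. ennreal (g z / c) \<partial>K)"
      by (simp add: emeasure_density cong: nn_integral_cong)
    also have "\<dots> = ennreal (\<integral>z. g z / c \<partial>K)"
      using ig g0 cpos by (intro nn_integral_eq_integral) auto
    also have "\<dots> = 1"
      using cK cpos by simp
    finally have "prob_space ?D" by (rule prob_spaceI)
    then interpret D: prob_space ?D .
    have rd: "real_distribution (distr ?D borel Z)"
      by (rule D.real_distribution_distr) simp
    have "measure (distr ?D borel Z) B = (\<integral>x. indicator B x \<partial>distr ?D borel Z)"
      by simp
    also have "\<dots> = (\<integral>z. indicator B (Z z) \<partial>?D)"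
      by (intro integral_distr) auto
    also have "\<dots> = (\<integral>z. (g z / c) *\<^sub>R indicator B (Z z) \<partial>K)"
      using g0 cpos by (intro integral_density) auto
    also have "\<dots> = (1/c) * (\<integral>z. g z * indicator B (Z z) \<partial>K)"
      by simp
    finally have 1: "(\<integral>z. g z * indicator B (Z z) \<partial>K) = c * measure (distr ?D borel Z) B"
      using cpos by simp
    have "char (distr ?D borel Z) t = (1 / c) *\<^sub>R (\<integral>z. g z *\<^sub>R iexp (t * Z z) \<partial>K)" for t
    proof -
      have "char (distr ?D borel Z) t = (\<integral>z. iexp (t * Z z) \<partial>?D)"
        unfolding char_def by (subst integral_distr) auto
      also have "\<dots> = (\<integral>z. (g z / c) *\<^sub>R iexp (t * Z z) \<partial>K)"
        using g0 cpos by (intro integral_density) auto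
      also have "\<dots> = (\<integral>z. (1 / c) *\<^sub>R (g z *\<^sub>R iexp (t * Z z)) \<partial>K)"
        by (intro Bochner_Integration.integral_cong) auto
      also have "\<dots> = (1 / c) *\<^sub>R (\<integral>z. g z *\<^sub>R iexp (t * Z z) \<partial>K)"
        by (rule integral_scaleR_right)
      finally show ?thesis .
    qed
    with 1 rd show ?thesis by blast
  qed
  show ?thesis
  proof (cases "c = 0")
    case True
    have "AE z in M. g z = 0"
      using int_gM True g0 by (subst (asm) c_def, subst (asm) integral_nonneg_eq_0_iff_AE) auto
    moreover have "AE z in N. g z = 0"
      using int_gN cN True g0 by (subst (asm) cN[symmetric], subst (asm) integral_nonneg_eq_0_iff_AE) auto
    ultimately have "(\<integral>z. g z * indicator B (Z z) \<partial>M) = 0" "(\<integral>z. g z * indicator B (Z z) \<partial>N) = 0"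
      by (auto intro!: integral_eq_zero_AE)
    then show ?thesis by simp
  next
    case False
    with c0 have cpos: "c > 0" by simp
    note mM = mass[OF cpos \<open>prob_space M\<close> Z(1) g(1) int_gM c_def[symmetric]]
    note mN = mass[OF cpos \<open>prob_space N\<close> Z(2) g(2) int_gN cN]
    have "distr (density M (\<lambda>z. g z / c)) borel Z = distr (density N (\<lambda>z. g z / c)) borel Z"
      using mM mN eq by (intro Levy_uniqueness ext) auto
    with mM mN show ?thesis by simp
  qed
qed

text \<open>
  In an expectation the factor \<open>exp (i t Z)\<close>, with \<open>t\<close> arbitrary, determines the factor \<open>indicator B Z\<close>, even in the
  presence of a further character \<open>exp (i h)\<close>.  That character is not a nonnegative weight, but
  \<open>1 + cos h\<close> and \<open>1 + sin h\<close> are, and they are combinations of the characters \<open>exp (i s h)\<close> with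
  \<open>s\<close> in \<open>{- 1, 0, 1}\<close>.
\<close>

lemma indicator_for_character:
  fixes Z g h :: "'a \<Rightarrow> real"
  assumes M: "prob_space M" and N: "prob_space N"
    and Z [measurable]: "Z \<in> borel_measurable M" "Z \<in> borel_measurable N"
    and g [measurable]: "g \<in> borel_measurable M" "g \<in> borel_measurable N"
    and h [measurable]: "h \<in> borel_measurable M" "h \<in> borel_measurable N"
    and g0: "\<And>z. 0 \<le> g z" and g1: "\<And>z. g z \<le> 1"
    and eq: "\<And>s t. (\<integral>z. g z *\<^sub>R iexp (s * h z + t * Z z) \<partial>M) = (\<integral>z. g z *\<^sub>R iexp (s * h z + t * Z z) \<partial>N)"
    and B [measurable]: "B \<in> sets borel"
  shows "(\<integral>z. (g z * indicator B (Z z)) *\<^sub>R iexp (h z) \<partial>M) = (\<integral>z. (g z * indicator B (Z z)) *\<^sub>R iexp (h z) \<partial>N)"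
proof -
  interpret M: prob_space M by fact
  interpret N: prob_space N by fact
  have int: "integrable K (\<lambda>z. g z *\<^sub>R iexp (s * h z + t * Z z))"
    if "prob_space K" and [measurable]: "g \<in> borel_measurable K" "h \<in> borel_measurable K" "Z \<in> borel_measurable K" for K s t
  proof -
    interpret K: prob_space K by fact
    show ?thesis
      by (rule K.integrable_const_bound[where B=1]) (auto simp: g0 g1)
  qed
  note intM = int[OF M g(1) h(1) Z(1)] and intN = int[OF N g(2) h(2) Z(2)]
  have rint: "integrable K (\<lambda>z. g z * indicator B (Z z) * f z)"
    if "prob_space K" and [measurable]: "g \<in> borel_measurable K" "Z \<in> borel_measurable K" "f \<in> borel_measurable K"
     and f: "\<And>z. \<bar>f z\<bar> \<le> 1" for K and f :: "'a \<Rightarrow> real"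
  proof -
    interpret K: prob_space K by fact
    show ?thesis
      by (rule K.integrable_const_bound[where B=1])
         (auto simp: g0 g1 f abs_mult intro!: mult_le_one split: split_indicator)
  qed
  have plain: "(\<integral>z. g z * indicator B (Z z) \<partial>M) = (\<integral>z. g z * indicator B (Z z) \<partial>N)"
    using eq[of 0] by (intro weighted_char_unique[OF M N, where C=1]) (auto simp: g0 g1)
  have cos: "(\<integral>z. g z * (1 + cos (h z)) * indicator B (Z z) \<partial>M) = (\<integral>z. g z * (1 + cos (h z)) * indicator B (Z z) \<partial>N)"
  proof (rule weighted_char_unique[OF M N, where C=2])
    have dec: "(\<integral>z. (g z * (1 + cos (h z))) *\<^sub>R iexp (t * Z z) \<partial>K) =
        (\<integral>z. g z *\<^sub>R iexp (0 * h z + t * Z z) \<partial>K) + (1/2) * (\<integral>z. g z *\<^sub>R iexp (1 * h z + t * Z z) \<partial>K)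
        + (1/2) * (\<integral>z. g z *\<^sub>R iexp ((-1) * h z + t * Z z) \<partial>K)"
      if i: "\<And>s t. integrable K (\<lambda>z. g z *\<^sub>R iexp (s * h z + t * Z z))" for K t
    proof -
      have "(g z * (1 + cos (h z))) *\<^sub>R iexp (t * Z z) = g z *\<^sub>R iexp (0 * h z + t * Z z) +
         (1/2) * (g z *\<^sub>R iexp (1 * h z + t * Z z)) + (1/2) * (g z *\<^sub>R iexp ((-1) * h z + t * Z z))" for z
        by (simp add: complex_eq_iff Re_exp Im_exp cos_add sin_add cos_diff sin_diff field_simps)
      then show ?thesis
        using i[of 0 t] i[of 1 t] i[of "-1" t]
        by (simp only: Bochner_Integration.integral_add integrable_mult_right Bochner_Integration.integrable_add integral_mult_right_zero)
    qed
    show "(\<integral>z. (g z * (1 + cos (h z))) *\<^sub>R iexp (t * Z z) \<partial>M) = (\<integral>z. (g z * (1 + cos (h z))) *\<^sub>R iexp (t * Z z) \<partial>N)" for t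
      by (simp only: dec[OF intM] dec[OF intN] eq)
    show "0 \<le> g z * (1 + cos (h z))" for z
      using cos_ge_minus_one[of "h z"] g0[of z] by (intro mult_nonneg_nonneg) linarith+
    show "g z * (1 + cos (h z)) \<le> 2" for z
      using mult_mono[of "g z" 1 "1 + cos (h z)" 2] cos_le_one[of "h z"] cos_ge_minus_one[of "h z"] g0[of z] g1[of z]
      by linarith
  qed auto
  have sin: "(\<integral>z. g z * (1 + sin (h z)) * indicator B (Z z) \<partial>M) = (\<integral>z. g z * (1 + sin (h z)) * indicator B (Z z) \<partial>N)"
  proof (rule weighted_char_unique[OF M N, where C=2])
    have dec: "(\<integral>z. (g z * (1 + sin (h z))) *\<^sub>R iexp (t * Z z) \<partial>K) =
        (\<integral>z. g z *\<^sub>R iexp (0 * h z + t * Z z) \<partial>K) + (-\<i>/2) * (\<integral>z. g z *\<^sub>R iexp (1 * h z + t * Z z) \<partial>K)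
        + (\<i>/2) * (\<integral>z. g z *\<^sub>R iexp ((-1) * h z + t * Z z) \<partial>K)"
      if i: "\<And>s t. integrable K (\<lambda>z. g z *\<^sub>R iexp (s * h z + t * Z z))" for K t
    proof -
      have "(g z * (1 + sin (h z))) *\<^sub>R iexp (t * Z z) = g z *\<^sub>R iexp (0 * h z + t * Z z) +
         (-\<i>/2) * (g z *\<^sub>R iexp (1 * h z + t * Z z)) + (\<i>/2) * (g z *\<^sub>R iexp ((-1) * h z + t * Z z))" for z
        by (simp add: complex_eq_iff Re_exp Im_exp cos_add sin_add cos_diff sin_diff field_simps)
      then show ?thesis
        using i[of 0 t] i[of 1 t] i[of "-1" t]
        by (simp only: Bochner_Integration.integral_add integrable_mult_right Bochner_Integration.integrable_add integral_mult_right_zero)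
    qed
    show "(\<integral>z. (g z * (1 + sin (h z))) *\<^sub>R iexp (t * Z z) \<partial>M) = (\<integral>z. (g z * (1 + sin (h z))) *\<^sub>R iexp (t * Z z) \<partial>N)" for t
      by (simp only: dec[OF intM] dec[OF intN] eq)
    show "0 \<le> g z * (1 + sin (h z))" for z
      using sin_ge_minus_one[of "h z"] g0[of z] by (intro mult_nonneg_nonneg) linarith+
    show "g z * (1 + sin (h z)) \<le> 2" for z
      using mult_mono[of "g z" 1 "1 + sin (h z)" 2] sin_le_one[of "h z"] sin_ge_minus_one[of "h z"] g0[of z] g1[of z]
      by linarith
  qed auto
  have "(\<integral>z. (g z * indicator B (Z z)) *\<^sub>R iexp (h z) \<partial>K) =
      complex_of_real ((\<integral>z. g z * (1 + cos (h z)) * indicator B (Z z) \<partial>K) - (\<integral>z. g z * indicator B (Z z) \<partial>K))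
      + \<i> * complex_of_real ((\<integral>z. g z * (1 + sin (h z)) * indicator B (Z z) \<partial>K) - (\<integral>z. g z * indicator B (Z z) \<partial>K))"
    if K: "prob_space K" and m [measurable]: "g \<in> borel_measurable K" "Z \<in> borel_measurable K" "h \<in> borel_measurable K" for K
  proof -
    have i1: "integrable K (\<lambda>z. g z * indicator B (Z z) * 1)"
      by (rule rint[OF K]) auto
    have ic: "integrable K (\<lambda>z. g z * indicator B (Z z) * cos (h z))"
      by (rule rint[OF K]) auto
    have isn: "integrable K (\<lambda>z. g z * indicator B (Z z) * sin (h z))"
      by (rule rint[OF K]) auto
    have 1: "(\<integral>z. g z * (1 + cos (h z)) * indicator B (Z z) \<partial>K) - (\<integral>z. g z * indicator B (Z z) \<partial>K)
        = (\<integral>z. g z * indicator B (Z z) * cos (h z) \<partial>K)"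
      using Bochner_Integration.integral_add[OF i1 ic] by (simp add: algebra_simps)
    have 2: "(\<integral>z. g z * (1 + sin (h z)) * indicator B (Z z) \<partial>K) - (\<integral>z. g z * indicator B (Z z) \<partial>K)
        = (\<integral>z. g z * indicator B (Z z) * sin (h z) \<partial>K)"
      using Bochner_Integration.integral_add[OF i1 isn] by (simp add: algebra_simps)
    have "(g z * indicator B (Z z)) *\<^sub>R iexp (h z) =
        complex_of_real (g z * indicator B (Z z) * cos (h z)) + \<i> * complex_of_real (g z * indicator B (Z z) * sin (h z))" for z
      by (simp add: complex_eq_iff Re_exp Im_exp)
    then show ?thesis
      unfolding 1 2 using ic isn
      by (simp only: Bochner_Integration.integral_add integrable_mult_right integrable_of_real integral_mult_right_zero integral_complex_of_real)
  qed
  from this[OF M g(1) Z(1) h(1)] this[OF N g(2) Z(2) h(2)] show ?thesis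
    by (simp only: plain cos sin)
qed

text \<open>
  The characters of the coordinates are exchanged for indicator functions one coordinate at a time.
  When all of them are exchanged, both measures agree on boxes.
\<close>

lemma PiM_char_unique:
  fixes M N :: "('i \<Rightarrow> real) measure"
  assumes I: "finite I" and M: "prob_space M" and N: "prob_space N"
    and sM [measurable_cong]: "sets M = sets (\<Pi>\<^sub>M i\<in>I. borel)" and sN [measurable_cong]: "sets N = sets (\<Pi>\<^sub>M i\<in>I. borel)"
    and eq: "\<And>a. (\<integral>z. iexp (\<Sum>i\<in>I. a i * z i) \<partial>M) = (\<integral>z. iexp (\<Sum>i\<in>I. a i * z i) \<partial>N)"
  shows "M = N"
proof -
  interpret M: prob_space M by fact
  interpret N: prob_space N by fact
  have step: "(\<integral>z. (\<Prod>i\<in>K. indicator (B i) (z i)) *\<^sub>R iexp (\<Sum>i\<in>I. a i * z i) \<partial>M) =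
      (\<integral>z. (\<Prod>i\<in>K. indicator (B i) (z i)) *\<^sub>R iexp (\<Sum>i\<in>I. a i * z i) \<partial>N)"
    if "finite K" "K \<subseteq> I" "\<And>i. i \<in> K \<Longrightarrow> B i \<in> sets borel" for K and B :: "'i \<Rightarrow> real set" and a
    using that
  proof (induction K arbitrary: a)
    case empty
    show ?case using eq by simp
  next
    case (insert k K)
    have kI: "k \<in> I" and [measurable]: "B k \<in> sets borel" "\<And>i. i \<in> K \<Longrightarrow> B i \<in> sets borel" "\<And>i. i \<in> K \<Longrightarrow> i \<in> I"
      using insert.prems by auto
    have [measurable]: "k \<in> I" by fact
    define g where "g z = (\<Prod>i\<in>K. indicator (B i) (z i) :: real)" for z :: "'i \<Rightarrow> real"
    have "(\<integral>z. (g z * indicator (B k) (z k)) *\<^sub>R iexp (\<Sum>i\<in>I. a i * z i) \<partial>M) =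
        (\<integral>z. (g z * indicator (B k) (z k)) *\<^sub>R iexp (\<Sum>i\<in>I. a i * z i) \<partial>N)"
    proof (rule indicator_for_character[OF M N])
      show "0 \<le> g z" "g z \<le> 1" for z
        unfolding g_def by (auto intro!: prod_nonneg prod_le_1)
      show "g \<in> borel_measurable M" "g \<in> borel_measurable N"
        unfolding g_def by measurable
      fix s t
      have lin: "s * (\<Sum>i\<in>I. a i * z i) + t * z k = (\<Sum>i\<in>I. (s * a i + (if i = k then t else 0)) * z i)" for z
        using I kI by (simp add: sum_distrib_left distrib_right sum.distrib mult.assoc if_distrib[of "\<lambda>c. c * _"] sum.delta cong: if_cong)
      show "(\<integral>z. g z *\<^sub>R iexp (s * (\<Sum>i\<in>I. a i * z i) + t * z k) \<partial>M) =
          (\<integral>z. g z *\<^sub>R iexp (s * (\<Sum>i\<in>I. a i * z i) + t * z k) \<partial>N)"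
        unfolding lin g_def using insert by (intro insert.IH) auto
    qed measurable
    then show ?case
      using insert.hyps by (simp add: g_def mult.commute)
  qed
  show ?thesis
  proof (rule measure_eqI_PiM_finite[OF I sM sN])
    fix A :: "'i \<Rightarrow> real set" assume A: "\<And>i. i \<in> I \<Longrightarrow> A i \<in> sets borel"
    have *: "emeasure K (Pi\<^sub>E I A) = ennreal (Re (\<integral>z. (\<Prod>i\<in>I. indicator (A i) (z i)) *\<^sub>R iexp (\<Sum>i\<in>I. 0 * z i) \<partial>K))"
      if "prob_space K" and sK: "sets K = sets (\<Pi>\<^sub>M i\<in>I. borel)" for K
    proof -
      interpret K: prob_space K by fact
      have sp: "space K = (\<Pi>\<^sub>E i\<in>I. UNIV)"
        using sets_eq_imp_space_eq[OF sK] by (simp add: space_PiM)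
      have "(\<Prod>i\<in>I. indicator (A i) (z i)) = (indicator (Pi\<^sub>E I A) z :: real)" if "z \<in> space K" for z
        using that I unfolding sp by (auto simp: indicator_def PiE_iff prod_zero_iff)
      then have "(\<integral>z. (\<Prod>i\<in>I. indicator (A i) (z i)) *\<^sub>R iexp (\<Sum>i\<in>I. 0 * z i) \<partial>K) =
          (\<integral>z. complex_of_real (indicator (Pi\<^sub>E I A) z) \<partial>K)"
        by (intro Bochner_Integration.integral_cong) (auto simp: scaleR_conv_of_real)
      also have "\<dots> = complex_of_real (measure K (Pi\<^sub>E I A))"
        unfolding integral_complex_of_real using sets.sets_into_space[of "Pi\<^sub>E I A" K] A I sK
        by (subst Bochner_Integration.integral_indicator) (auto intro!: sets_PiM_I_finite simp: Int_absorb2 K.emeasure_eq_measure)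
      finally show ?thesis by (simp add: K.emeasure_eq_measure)
    qed
    show "emeasure M (Pi\<^sub>E I A) = emeasure N (Pi\<^sub>E I A)"
      unfolding *[OF M sM] *[OF N sN] using step[OF I, of A "\<lambda>_. 0"] A by simp
  next
    show "range (\<lambda>_::nat. Pi\<^sub>E I (\<lambda>_. UNIV::real set)) \<subseteq> prod_algebra I (\<lambda>_. borel)"
      using I by (auto intro!: prod_algebraI_finite)
    show "(\<Union>i::nat. Pi\<^sub>E I (\<lambda>_. UNIV::real set)) = space (Pi\<^sub>M I (\<lambda>_. borel))"
      by (simp add: space_PiM)
    show "emeasure M (Pi\<^sub>E I (\<lambda>_. UNIV)) \<noteq> \<infinity>" for i :: nat
      by simp
  qed
qed

section \<open>Gaussian laws as images of standard Gaussian measures\<close>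

abbreviation std_gaussian :: "'i set \<Rightarrow> ('i \<Rightarrow> real) measure" where
  "std_gaussian I \<equiv> (\<Pi>\<^sub>M i\<in>I. std_normal_distribution)"

lemma prob_space_std_normal: "prob_space std_normal_distribution"
  by (rule prob_space_normal_density) simp

lemma prob_space_std_gaussian: "prob_space (std_gaussian I)"
  by (intro prob_space_PiM prob_space_std_normal)

lemma sets_std_gaussian [measurable_cong]: "sets (std_gaussian I) = sets (\<Pi>\<^sub>M i\<in>I. borel)"
  by (intro sets_PiM_cong) auto

lemma space_std_gaussian: "space (std_gaussian I) = (\<Pi>\<^sub>E i\<in>I. UNIV)"
  by (simp add: space_PiM)

lemma char_std_gaussian:
  assumes I: "finite I"
  shows "(\<integral>z. iexp (\<Sum>i\<in>I. a i * z i) \<partial>std_gaussian I) = complex_of_real (exp (- (\<Sum>i\<in>I. (a i)\<^sup>2) / 2))"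
proof -
  interpret prob_space std_normal_distribution by (rule prob_space_std_normal)
  interpret product_sigma_finite "\<lambda>_. std_normal_distribution" ..
  have "(\<integral>z. iexp (\<Sum>i\<in>I. a i * z i) \<partial>std_gaussian I) = (\<integral>z. (\<Prod>i\<in>I. iexp (a i * z i)) \<partial>std_gaussian I)"
    using I by (simp add: sum_distrib_left exp_sum)
  also have "\<dots> = (\<Prod>i\<in>I. char std_normal_distribution (a i))"
    unfolding char_def using I by (intro product_integral_prod integrable_iexp) auto
  also have "\<dots> = complex_of_real (\<Prod>i\<in>I. exp (- (a i)\<^sup>2 / 2))"
    by (simp add: char_std_normal_distribution)
  also have "(\<Prod>i\<in>I. exp (- (a i)\<^sup>2 / 2)) = exp (- (\<Sum>i\<in>I. (a i)\<^sup>2) / 2)"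
    using I by (simp add: exp_sum[symmetric] sum_divide_distrib sum_negf[symmetric] del: sum_negf)
  finally show ?thesis .
qed

text \<open>
  For \<open>s = 0\<close> both sides are point masses; in this form singular and nonsingular covariance matrices can
  be treated alike.
\<close>

lemma normal_law_affine:
  assumes "0 \<le> s"
  shows "normal_law m (s\<^sup>2) = distr std_normal_distribution borel (\<lambda>x. m + s * x)"
proof (cases "s = 0")
  case True
  interpret prob_space std_normal_distribution by (rule prob_space_std_normal)
  show ?thesis using True by (simp add: normal_law_def distr_const)
next
  case False
  with assms have s: "s > 0" by simp
  interpret prob_space std_normal_distribution by (rule prob_space_std_normal)
  have "distributed std_normal_distribution lborel (\<lambda>x. x) std_normal_density"
    by (auto simp: distributed_def distr_id2)
  from normal_density_affine[OF this, of s m] s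
  have "distributed std_normal_distribution lborel (\<lambda>x. m + s * x) (normal_density m s)"
    by simp
  then have "distr std_normal_distribution lborel (\<lambda>x. m + s * x) = density lborel (normal_density m s)"
    by (simp add: distributed_def)
  moreover have "distr std_normal_distribution lborel (\<lambda>x. m + s * x) = distr std_normal_distribution borel (\<lambda>x. m + s * x)"
    by (intro distr_cong) auto
  ultimately show ?thesis using s by (simp add: normal_law_def)
qed

lemma real_distribution_normal_law: "0 \<le> v \<Longrightarrow> real_distribution (normal_law m v)"
  using normal_law_affine[of "sqrt v" m] prob_space.real_distribution_distr[OF prob_space_std_normal, of "\<lambda>x. m + sqrt v * x"]
  by simp

lemma char_normal_law:
  assumes "0 \<le> v"
  shows "char (normal_law m v) t = iexp (t * m) * complex_of_real (exp (- (v * t\<^sup>2) / 2))"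
proof -
  have "char (normal_law m v) t = (\<integral>x. iexp (t * m) * iexp ((t * sqrt v) * x) \<partial>std_normal_distribution)"
    using normal_law_affine[of "sqrt v" m] assms
    by (simp add: char_def integral_distr ring_distribs exp_add mult_ac)
  also have "\<dots> = iexp (t * m) * char std_normal_distribution (t * sqrt v)"
    unfolding char_def by (rule integral_mult_right_zero)
  also have "\<dots> = iexp (t * m) * complex_of_real (exp (- (v * t\<^sup>2) / 2))"
    using assms by (simp add: char_std_normal_distribution power_mult_distrib mult_ac)
  finally show ?thesis .
qed

lemma distr_std_gaussian_linear_form:
  assumes I: "finite I"
  shows "distr (std_gaussian I) borel (\<lambda>z. m + (\<Sum>i\<in>I. b i * z i)) = normal_law m (\<Sum>i\<in>I. (b i)\<^sup>2)"
proof (rule Levy_uniqueness)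
  interpret prob_space "std_gaussian I" by (rule prob_space_std_gaussian)
  show "real_distribution (distr (std_gaussian I) borel (\<lambda>z. m + (\<Sum>i\<in>I. b i * z i)))"
    by (rule real_distribution_distr) measurable
  show "real_distribution (normal_law m (\<Sum>i\<in>I. (b i)\<^sup>2))"
    by (intro real_distribution_normal_law sum_nonneg) auto
  show "char (distr (std_gaussian I) borel (\<lambda>z. m + (\<Sum>i\<in>I. b i * z i))) = char (normal_law m (\<Sum>i\<in>I. (b i)\<^sup>2))"
  proof
    fix t
    have "char (distr (std_gaussian I) borel (\<lambda>z. m + (\<Sum>i\<in>I. b i * z i))) t =
        (\<integral>z. iexp (t * m) * iexp (\<Sum>i\<in>I. (t * b i) * z i) \<partial>std_gaussian I)"
      unfolding char_def
      by (subst integral_distr) (auto simp: ring_distribs exp_add mult_ac sum_distrib_left)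
    also have "\<dots> = iexp (t * m) * complex_of_real (exp (- (\<Sum>i\<in>I. (t * b i)\<^sup>2) / 2))"
      unfolding char_std_gaussian[OF I, symmetric] by (rule integral_mult_right_zero)
    also have "(\<Sum>i\<in>I. (t * b i)\<^sup>2) = (\<Sum>i\<in>I. (b i)\<^sup>2) * t\<^sup>2"
      by (simp add: power_mult_distrib sum_distrib_left mult.commute)
    finally show "char (distr (std_gaussian I) borel (\<lambda>z. m + (\<Sum>i\<in>I. b i * z i))) t =
        char (normal_law m (\<Sum>i\<in>I. (b i)\<^sup>2)) t"
      by (simp add: char_normal_law sum_nonneg)
  qed
qed

text \<open>
  Orthonormal linear forms of independent standard normal variables are again independent and
  standard normal: the characteristic function depends only on the norm of the combined
  coefficient vector, which an orthonormal system preserves.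
\<close>

lemma orthonormal_image_std_gaussian:
  fixes A :: "'j \<Rightarrow> 'i \<Rightarrow> real"
  assumes I: "finite I" and J: "finite J"
    and A: "\<And>m k. m \<in> J \<Longrightarrow> k \<in> J \<Longrightarrow> (\<Sum>i\<in>I. A m i * A k i) = (if m = k then 1 else 0)"
  shows "distr (std_gaussian I) (\<Pi>\<^sub>M m\<in>J. borel) (\<lambda>z. \<lambda>m\<in>J. \<Sum>i\<in>I. A m i * z i) = std_gaussian J"
    (is "?D = _")
proof (rule PiM_char_unique[OF J _ prob_space_std_gaussian])
  have [measurable]: "(\<lambda>z. \<lambda>m\<in>J. \<Sum>i\<in>I. A m i * z i) \<in> measurable (std_gaussian I) (\<Pi>\<^sub>M m\<in>J. borel)"
    by measurable
  show "prob_space ?D"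
    by (rule prob_space.prob_space_distr[OF prob_space_std_gaussian]) measurable
  show "sets ?D = sets (\<Pi>\<^sub>M m\<in>J. borel)" by simp
  show "sets (std_gaussian J) = sets (\<Pi>\<^sub>M m\<in>J. borel)" by (rule sets_std_gaussian)
  fix a
  have "(\<integral>z. iexp (\<Sum>m\<in>J. a m * z m) \<partial>?D) =
      (\<integral>z. iexp (\<Sum>m\<in>J. a m * (\<lambda>m\<in>J. \<Sum>i\<in>I. A m i * z i) m) \<partial>std_gaussian I)"
    by (rule integral_distr) measurable
  also have "\<dots> = (\<integral>z. iexp (\<Sum>i\<in>I. (\<Sum>m\<in>J. a m * A m i) * z i) \<partial>std_gaussian I)"
  proof (intro Bochner_Integration.integral_cong refl arg_cong[where f=iexp])
    fix z
    show "(\<Sum>m\<in>J. a m * (\<lambda>m\<in>J. \<Sum>i\<in>I. A m i * z i) m) = (\<Sum>i\<in>I. (\<Sum>m\<in>J. a m * A m i) * z i)"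
      by (subst sum.cong[OF refl, of J _ "\<lambda>m. \<Sum>i\<in>I. a m * A m i * z i"])
         (simp_all add: sum_distrib_left sum_distrib_right mult.assoc sum.swap[of _ I J])
  qed
  also have "\<dots> = complex_of_real (exp (- (\<Sum>i\<in>I. (\<Sum>m\<in>J. a m * A m i)\<^sup>2) / 2))"
    by (rule char_std_gaussian[OF I])
  also have "(\<Sum>i\<in>I. (\<Sum>m\<in>J. a m * A m i)\<^sup>2) = (\<Sum>m\<in>J. (a m)\<^sup>2)"
  proof -
    have "(\<Sum>i\<in>I. (\<Sum>m\<in>J. a m * A m i)\<^sup>2) = (\<Sum>i\<in>I. \<Sum>m\<in>J. \<Sum>k\<in>J. a m * a k * (A m i * A k i))"
      by (simp add: power2_eq_square sum_product mult_ac)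
    also have "\<dots> = (\<Sum>m\<in>J. \<Sum>k\<in>J. a m * a k * (\<Sum>i\<in>I. A m i * A k i))"
      by (simp add: sum_distrib_left sum.swap[of _ I J])
    also have "\<dots> = (\<Sum>m\<in>J. \<Sum>k\<in>J. if m = k then a m * a k else 0)"
      by (intro sum.cong refl) (simp add: A)
    also have "\<dots> = (\<Sum>m\<in>J. (a m)\<^sup>2)"
      using J by (simp add: power2_eq_square)
    finally show ?thesis .
  qed
  also have "complex_of_real (exp (- (\<Sum>m\<in>J. (a m)\<^sup>2) / 2)) = (\<integral>z. iexp (\<Sum>m\<in>J. a m * z m) \<partial>std_gaussian J)"
    by (rule char_std_gaussian[OF J, symmetric])
  finally show "(\<integral>z. iexp (\<Sum>m\<in>J. a m * z m) \<partial>?D) = (\<integral>z. iexp (\<Sum>m\<in>J. a m * z m) \<partial>std_gaussian J)" .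
qed

lemma char_is_gaussian:
  assumes G: "is_gaussian p \<mu> S N"
  shows "(\<integral>z. iexp (\<Sum>j<p. a j * z j) \<partial>N) =
    char (normal_law (\<Sum>j<p. a j * \<mu> j) (\<Sum>j<p. \<Sum>l<p. a j * S j l * a l)) 1"
proof -
  have [measurable_cong]: "sets N = sets (vec_space p)"
    using G by (simp add: is_gaussian_def)
  have "(\<integral>z. iexp (\<Sum>j<p. a j * z j) \<partial>N) = char (distr N borel (\<lambda>z. \<Sum>j<p. a j * z j)) 1"
    unfolding char_def by (subst integral_distr) auto
  then show ?thesis using G by (simp add: is_gaussian_def)
qed

text \<open>
  The theorem of Cramer and Wold: the laws of all linear forms determine the characteristic function.
\<close>

lemma is_gaussian_unique:
  assumes "is_gaussian p \<mu> S N" "is_gaussian p \<mu> S N'"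
  shows "N = N'"
  using assms char_is_gaussian[OF assms(1)] char_is_gaussian[OF assms(2)]
  by (intro PiM_char_unique[of "{..<p}"]) (auto simp: is_gaussian_def)

text \<open>
  This resolves the definite description in \<open>gaussian\<close>.  The covariance may be singular; it only
  has to be factored as \<open>A A\<^sup>T\<close>, and a sample covariance matrix comes with such a factorization.
\<close>

lemma gaussian_affine:
  fixes A :: "nat \<Rightarrow> 'i \<Rightarrow> real"
  assumes I: "finite I"
    and S: "\<And>j l. j < p \<Longrightarrow> l < p \<Longrightarrow> S j l = (\<Sum>i\<in>I. A j i * A l i)"
  shows "gaussian p \<mu> S = distr (std_gaussian I) (vec_space p) (\<lambda>z. \<lambda>j\<in>{..<p}. \<mu> j + (\<Sum>i\<in>I. A j i * z i))"
    (is "_ = ?D")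
proof -
  have [measurable]: "(\<lambda>z. \<lambda>j\<in>{..<p}. \<mu> j + (\<Sum>i\<in>I. A j i * z i)) \<in> measurable (std_gaussian I) (vec_space p)"
    by measurable
  have "is_gaussian p \<mu> S ?D"
    unfolding is_gaussian_def
  proof (intro conjI allI)
    show "prob_space ?D"
      by (rule prob_space.prob_space_distr[OF prob_space_std_gaussian]) measurable
    show "sets ?D = sets (vec_space p)" by simp
    fix a
    have "distr ?D borel (\<lambda>z. \<Sum>j<p. a j * z j) =
        distr (std_gaussian I) borel ((\<lambda>z. \<Sum>j<p. a j * z j) \<circ> (\<lambda>z. \<lambda>j\<in>{..<p}. \<mu> j + (\<Sum>i\<in>I. A j i * z i)))"
      by (rule distr_distr) measurable
    also have "((\<lambda>z. \<Sum>j<p. a j * z j) \<circ> (\<lambda>z. \<lambda>j\<in>{..<p}. \<mu> j + (\<Sum>i\<in>I. A j i * z i))) =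
        (\<lambda>z. (\<Sum>j<p. a j * \<mu> j) + (\<Sum>i\<in>I. (\<Sum>j<p. a j * A j i) * z i))"
    proof
      fix z
      have "(\<Sum>i\<in>I. (\<Sum>j<p. a j * A j i) * z i) = (\<Sum>j<p. a j * (\<Sum>i\<in>I. A j i * z i))"
        by (simp add: sum_distrib_left sum_distrib_right mult.assoc sum.swap[of _ I "{..<p}"])
      then show "((\<lambda>z. \<Sum>j<p. a j * z j) \<circ> (\<lambda>z. \<lambda>j\<in>{..<p}. \<mu> j + (\<Sum>i\<in>I. A j i * z i))) z =
          (\<Sum>j<p. a j * \<mu> j) + (\<Sum>i\<in>I. (\<Sum>j<p. a j * A j i) * z i)"
        by (simp add: ring_distribs sum.distrib)
    qed
    also have "distr (std_gaussian I) borel \<dots> = normal_law (\<Sum>j<p. a j * \<mu> j) (\<Sum>i\<in>I. (\<Sum>j<p. a j * A j i)\<^sup>2)"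
      by (rule distr_std_gaussian_linear_form[OF I])
    also have "(\<Sum>i\<in>I. (\<Sum>j<p. a j * A j i)\<^sup>2) = (\<Sum>j<p. \<Sum>l<p. a j * S j l * a l)"
    proof -
      have "(\<Sum>i\<in>I. (\<Sum>j<p. a j * A j i)\<^sup>2) = (\<Sum>i\<in>I. \<Sum>j<p. \<Sum>l<p. a j * (A j i * A l i) * a l)"
        by (simp add: power2_eq_square sum_product mult_ac)
      also have "\<dots> = (\<Sum>j<p. \<Sum>l<p. a j * (\<Sum>i\<in>I. A j i * A l i) * a l)"
        by (simp add: sum_distrib_left sum_distrib_right sum.swap[of _ I "{..<p}"])
      also have "\<dots> = (\<Sum>j<p. \<Sum>l<p. a j * S j l * a l)"
        by (intro sum.cong refl) (simp add: S)
      finally show ?thesis .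
    qed
    finally show "distr ?D borel (\<lambda>z. \<Sum>j<p. a j * z j) =
        normal_law (\<Sum>j<p. a j * \<mu> j) (\<Sum>j<p. \<Sum>l<p. a j * S j l * a l)" .
  qed
  then show ?thesis
    unfolding gaussian_def by (intro the_equality is_gaussian_unique)
qed

text \<open>
  Completing the square turns \<open>exp (t x)\<close> times the density at \<open>0\<close> into a multiple of the density
  shifted by \<open>t\<close>.
\<close>

lemma std_normal_mgf:
  "(\<integral>\<^sup>+x. ennreal (exp (t * x)) \<partial>std_normal_distribution) = ennreal (exp (t\<^sup>2 / 2))"
proof -
  have shift: "std_normal_density x * exp (t * x) = exp (t\<^sup>2 / 2) * normal_density t 1 x" for x
    by (simp add: normal_density_def mult_exp_exp power2_eq_square algebra_simps add_divide_distrib[symmetric])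
  have "(\<integral>\<^sup>+x. ennreal (exp (t * x)) \<partial>std_normal_distribution) = (\<integral>\<^sup>+x. ennreal (std_normal_density x * exp (t * x)) \<partial>lborel)"
    by (subst nn_integral_density) (auto simp: ennreal_mult)
  also have "\<dots> = (\<integral>\<^sup>+x. ennreal (exp (t\<^sup>2 / 2)) * ennreal (normal_density t 1 x) \<partial>lborel)"
    unfolding shift by (simp add: ennreal_mult)
  also have "\<dots> = ennreal (exp (t\<^sup>2 / 2)) * (\<integral>\<^sup>+x. ennreal (normal_density t 1 x) \<partial>lborel)"
    by (rule nn_integral_cmult) simp
  also have "(\<integral>\<^sup>+x. ennreal (normal_density t 1 x) \<partial>lborel) = 1"
    by (subst nn_integral_eq_integral) auto
  finally show ?thesis by simp
qed

text \<open>
  Chernoff's bound with the optimal parameter \<open>s\<close>, for both signs of \<open>x\<close>.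
\<close>

lemma std_normal_tail:
  assumes "0 \<le> s"
  shows "measure std_normal_distribution {x. s \<le> \<bar>x\<bar>} \<le> 2 * exp (- s\<^sup>2 / 2)"
proof -
  interpret prob_space std_normal_distribution by (rule prob_space_std_normal)
  have one_sided: "measure std_normal_distribution {x. s\<^sup>2 \<le> r * s * x} \<le> exp (- s\<^sup>2 / 2)" if r: "r\<^sup>2 = 1" for r
  proof -
    have "emeasure std_normal_distribution {x. s\<^sup>2 \<le> r * s * x} \<le>
      (\<integral>\<^sup>+x. ennreal (exp (- s\<^sup>2)) * ennreal (exp ((r * s) * x)) \<partial>std_normal_distribution)"
    proof -
      have "emeasure std_normal_distribution {x. s\<^sup>2 \<le> r * s * x} = (\<integral>\<^sup>+x. indicator {x. s\<^sup>2 \<le> r * s * x} x \<partial>std_normal_distribution)"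
        by (subst nn_integral_indicator) auto
      also have "\<dots> \<le> (\<integral>\<^sup>+x. ennreal (exp (- s\<^sup>2)) * ennreal (exp ((r * s) * x)) \<partial>std_normal_distribution)"
        by (intro nn_integral_mono) (auto simp: indicator_def ennreal_mult[symmetric] mult_exp_exp ennreal_1[symmetric] simp del: ennreal_1)
      finally show ?thesis .
    qed
    also have "\<dots> = ennreal (exp (- s\<^sup>2)) * ennreal (exp ((r * s)\<^sup>2 / 2))"
      by (subst nn_integral_cmult) (auto simp: std_normal_mgf)
    also have "\<dots> = ennreal (exp (- s\<^sup>2 / 2))"
      using r by (simp add: ennreal_mult[symmetric] mult_exp_exp power_mult_distrib)
    finally show ?thesis
      by (simp add: emeasure_eq_measure)
  qed
  have "{x. s \<le> \<bar>x\<bar>} \<subseteq> {x. s\<^sup>2 \<le> 1 * s * x} \<union> {x. s\<^sup>2 \<le> (-1) * s * x}"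
  proof
    fix x assume "x \<in> {x. s \<le> \<bar>x\<bar>}"
    then have "s * s \<le> s * \<bar>x\<bar>" using assms by (auto intro: mult_left_mono)
    then show "x \<in> {x. s\<^sup>2 \<le> 1 * s * x} \<union> {x. s\<^sup>2 \<le> (-1) * s * x}"
      by (cases "0 \<le> x") (auto simp: power2_eq_square)
  qed
  then have "measure std_normal_distribution {x. s \<le> \<bar>x\<bar>} \<le>
      measure std_normal_distribution ({x. s\<^sup>2 \<le> 1 * s * x} \<union> {x. s\<^sup>2 \<le> (-1) * s * x})"
    by (rule finite_measure_mono) simp
  also have "\<dots> \<le> measure std_normal_distribution {x. s\<^sup>2 \<le> 1 * s * x} + measure std_normal_distribution {x. s\<^sup>2 \<le> (-1) * s * x}"
    by (rule measure_Un_le) auto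
  also have "\<dots> \<le> exp (- s\<^sup>2 / 2) + exp (- s\<^sup>2 / 2)"
    by (intro add_mono one_sided) auto
  finally show ?thesis by simp
qed

section \<open>Linear forms of a standard Gaussian vector\<close>

lemma std_normal_interval_pos:
  assumes "a < b"
  shows "0 < measure std_normal_distribution {a<..<b}"
proof -
  interpret prob_space std_normal_distribution by (rule prob_space_std_normal)
  have pos: "ennreal (std_normal_density x) \<noteq> 0" for x
    by (simp add: ennreal_eq_0_iff not_le normal_density_pos)
  have "emeasure std_normal_distribution {a<..<b} \<noteq> 0"
  proof
    assume "emeasure std_normal_distribution {a<..<b} = 0"
    then have "{a<..<b} \<in> null_sets std_normal_distribution" by (intro null_setsI) auto
    then have "AE x in lborel. x \<in> {a<..<b} \<longrightarrow> ennreal (std_normal_density x) = 0"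
      by (subst (asm) null_sets_density_iff) auto
    then have "AE x in lborel. x \<notin> {a<..<b}"
      using pos by simp
    then have "{a<..<b} \<in> null_sets lborel"
      by (subst (asm) AE_iff_null_sets[symmetric]) auto
    then show False using assms by (auto simp: null_sets_def)
  qed
  then show ?thesis
    by (simp add: emeasure_eq_measure zero_less_measure_iff)
qed

lemma std_normal_singleton: "measure std_normal_distribution {x} = 0"
proof -
  have "AE y in lborel. y \<in> {x} \<longrightarrow> ennreal (std_normal_density y) = 0"
    using AE_lborel_singleton[of x] by eventually_elim simp
  then have "{x} \<in> null_sets std_normal_distribution"
    by (subst null_sets_density_iff) simp_all
  then show ?thesis by (auto simp: null_sets_def measure_def)
qed

lemma std_gaussian_linear_form_std_normal:
  assumes "finite I" "(\<Sum>i\<in>I. (b i)\<^sup>2) = 1"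
  shows "distr (std_gaussian I) borel (\<lambda>z. \<Sum>i\<in>I. b i * z i) = std_normal_distribution"
  using distr_std_gaussian_linear_form[OF assms(1), of 0 b] assms(2) by (simp add: normal_law_def)

lemma std_gaussian_tail:
  assumes I: "finite I" and b: "(\<Sum>i\<in>I. (b i)\<^sup>2) = 1" and s: "0 \<le> s"
  shows "measure (std_gaussian I) {z \<in> space (std_gaussian I). s \<le> \<bar>\<Sum>i\<in>I. b i * z i\<bar>} \<le> 2 * exp (- s\<^sup>2 / 2)"
proof -
  have "measure (std_gaussian I) {z \<in> space (std_gaussian I). s \<le> \<bar>\<Sum>i\<in>I. b i * z i\<bar>} =
      measure (distr (std_gaussian I) borel (\<lambda>z. \<Sum>i\<in>I. b i * z i)) {x. s \<le> \<bar>x\<bar>}"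
    by (subst measure_distr) (auto intro!: arg_cong[where f="measure _"])
  then show ?thesis
    using std_normal_tail[OF s] by (simp add: std_gaussian_linear_form_std_normal[OF I b])
qed

lemma std_gaussian_level_set_null:
  assumes I: "finite I" and i: "i0 \<in> I" "b i0 \<noteq> 0"
  shows "measure (std_gaussian I) {z \<in> space (std_gaussian I). (\<Sum>i\<in>I. b i * z i) = x} = 0"
proof -
  define d where "d = sqrt (\<Sum>i\<in>I. (b i)\<^sup>2)"
  have pos: "0 < (\<Sum>i\<in>I. (b i)\<^sup>2)"
    using I i by (intro sum_pos2[of _ i0]) auto
  then have d: "d > 0" "d\<^sup>2 = (\<Sum>i\<in>I. (b i)\<^sup>2)" by (auto simp: d_def)
  have unit: "(\<Sum>i\<in>I. (b i / d)\<^sup>2) = 1"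
    using pos by (simp add: power_divide sum_divide_distrib[symmetric] d)
  have "(\<Sum>i\<in>I. b i / d * z i) = (\<Sum>i\<in>I. b i * z i) / d" for z
    by (simp add: sum_divide_distrib)
  then have "measure (std_gaussian I) {z \<in> space (std_gaussian I). (\<Sum>i\<in>I. b i * z i) = x} =
      measure (distr (std_gaussian I) borel (\<lambda>z. \<Sum>i\<in>I. b i / d * z i)) {x / d}"
    using d by (subst measure_distr) (auto intro!: arg_cong[where f="measure _"])
  then show ?thesis
    by (simp only: std_gaussian_linear_form_std_normal[OF I unit] std_normal_singleton)
qed

lemma std_gaussian_box_pos:
  assumes I: "finite I" and d: "0 < \<delta>"
  shows "0 < measure (std_gaussian I) (\<Pi>\<^sub>E i\<in>I. {e i - \<delta><..<e i + \<delta>})"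
proof -
  interpret prob_space std_normal_distribution by (rule prob_space_std_normal)
  interpret finite_product_prob_space "\<lambda>_. std_normal_distribution" I
    by standard (fact I)
  show ?thesis
    using d by (subst finite_measure_PiM_emb) (auto intro!: prod_pos std_normal_interval_pos)
qed

section \<open>Quantiles of the maximum of finitely many linear forms\<close>

definition max_form :: "'i set \<Rightarrow> nat \<Rightarrow> (nat \<Rightarrow> 'i \<Rightarrow> real) \<Rightarrow> ('i \<Rightarrow> real) \<Rightarrow> real" where
  "max_form I p B z = (MAX j\<in>{..<p}. \<bar>\<Sum>i\<in>I. B j i * z i\<bar>)"

lemma max_form_le_iff: "p > 0 \<Longrightarrow> max_form I p B z \<le> t \<longleftrightarrow> (\<forall>j<p. \<bar>\<Sum>i\<in>I. B j i * z i\<bar> \<le> t)"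
  unfolding max_form_def by (subst Max_le_iff) auto

lemma max_form_attained: "p > 0 \<Longrightarrow> \<exists>j<p. max_form I p B z = \<bar>\<Sum>i\<in>I. B j i * z i\<bar>"
proof -
  assume "p > 0"
  then have "max_form I p B z \<in> (\<lambda>j. \<bar>\<Sum>i\<in>I. B j i * z i\<bar>) ` {..<p}"
    unfolding max_form_def by (intro Max_in) auto
  then show ?thesis by auto
qed

lemma measurable_max_form [measurable]:
  "finite I \<Longrightarrow> max_form I p B \<in> borel_measurable (\<Pi>\<^sub>M i\<in>I. borel)"
  unfolding max_form_def by measurable

text \<open>
  The maximum is a continuous function that takes the value \<open>(x + y) / 2\<close> at a suitable multiple of a unit
  vector, hence values between \<open>x\<close> and \<open>y\<close> on a whole box around it, and boxes have positive
  Gaussian measure.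
\<close>

lemma max_form_interval_pos:
  assumes I: "finite I" and j0: "j0 < p" and i0: "i0 \<in> I" "B j0 i0 \<noteq> 0" and xy: "0 \<le> x" "x < y"
  shows "0 < measure (std_gaussian I) {z \<in> space (std_gaussian I). x < max_form I p B z \<and> max_form I p B z \<le> y}"
proof -
  interpret prob_space "std_gaussian I" by (rule prob_space_std_gaussian)
  have p: "p > 0" using j0 by simp
  \<comment> \<open>along the unit vector of \<open>i0\<close> the maximum grows with slope \<open>C\<close>\<close>
  define C where "C = (MAX j\<in>{..<p}. \<bar>B j i0\<bar>)"
  have C_ge: "\<bar>B j i0\<bar> \<le> C" if "j < p" for j
    unfolding C_def using that by (intro Max_ge) auto
  have "C \<in> (\<lambda>j. \<bar>B j i0\<bar>) ` {..<p}"
    unfolding C_def using p by (intro Max_in) auto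
  then obtain j1 where j1: "j1 < p" "\<bar>B j1 i0\<bar> = C" by auto
  have C: "C > 0" using C_ge[OF j0] i0 by linarith
  define m where "m = (x + y) / 2"
  \<comment> \<open>a Lipschitz constant of all the forms for the maximum norm\<close>
  define L where "L = 1 + (\<Sum>j<p. \<Sum>i\<in>I. \<bar>B j i\<bar>)"
  have L: "L > 0" unfolding L_def by (intro add_pos_nonneg sum_nonneg) auto
  have L_ge: "(\<Sum>i\<in>I. \<bar>B j i\<bar>) \<le> L" if "j < p" for j
    unfolding L_def using that member_le_sum[of j "{..<p}" "\<lambda>j. \<Sum>i\<in>I. \<bar>B j i\<bar>"]
    by (force intro: sum_nonneg)
  define \<delta> where "\<delta> = (y - x) / (4 * L)"
  have \<delta>: "\<delta> > 0" "L * \<delta> = (y - x) / 4" using xy L by (auto simp: \<delta>_def)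
  define e where "e i = (if i = i0 then m / C else 0)" for i
  have form_e: "\<bar>\<Sum>i\<in>I. B j i * e i\<bar> = \<bar>B j i0\<bar> * m / C" for j
    using I i0 C xy by (simp add: e_def if_distrib[of "\<lambda>c. _ * c"] abs_mult m_def cong: if_cong)
  have "(\<Pi>\<^sub>E i\<in>I. {e i - \<delta><..<e i + \<delta>}) \<subseteq> {z \<in> space (std_gaussian I). x < max_form I p B z \<and> max_form I p B z \<le> y}"
  proof
    fix z assume z: "z \<in> (\<Pi>\<^sub>E i\<in>I. {e i - \<delta><..<e i + \<delta>})"
    have close: "\<bar>(\<Sum>i\<in>I. B j i * z i) - (\<Sum>i\<in>I. B j i * e i)\<bar> \<le> (y - x) / 4" if "j < p" for j
    proof -
      have "\<bar>(\<Sum>i\<in>I. B j i * z i) - (\<Sum>i\<in>I. B j i * e i)\<bar> = \<bar>\<Sum>i\<in>I. B j i * (z i - e i)\<bar>"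
        by (simp add: sum_subtractf right_diff_distrib)
      also have "\<dots> \<le> (\<Sum>i\<in>I. \<bar>B j i * (z i - e i)\<bar>)" by (rule sum_abs)
      also have "\<dots> \<le> (\<Sum>i\<in>I. \<bar>B j i\<bar> * \<delta>)"
      proof (rule sum_mono)
        fix i assume "i \<in> I"
        then have "\<bar>z i - e i\<bar> \<le> \<delta>" using z by (force simp: PiE_iff abs_le_iff)
        then show "\<bar>B j i * (z i - e i)\<bar> \<le> \<bar>B j i\<bar> * \<delta>"
          by (simp add: abs_mult mult_left_mono)
      qed
      also have "\<dots> = (\<Sum>i\<in>I. \<bar>B j i\<bar>) * \<delta>" by (simp add: sum_distrib_right)
      also have "\<dots> \<le> L * \<delta>" using \<delta> L_ge[OF that] by (intro mult_right_mono) auto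
      finally show ?thesis using \<delta> by simp
    qed
    have m: "m > 0" "m - (y - x) / 4 > x" "m + (y - x) / 4 \<le> y" using xy by (auto simp: m_def field_simps)
    have "\<bar>\<Sum>i\<in>I. B j i * z i\<bar> \<le> y" if j: "j < p" for j
    proof -
      have "\<bar>B j i0\<bar> * m / C \<le> m" using C_ge[OF j] C m by (simp add: field_simps)
      with close[OF j] form_e[of j] m show ?thesis by linarith
    qed
    then have up: "max_form I p B z \<le> y" using p by (simp add: max_form_le_iff)
    have "\<bar>\<Sum>i\<in>I. B j1 i * e i\<bar> = m" using C by (simp add: form_e j1)
    with close[OF j1(1)] m have "x < \<bar>\<Sum>i\<in>I. B j1 i * z i\<bar>" by linarith
    then have "\<not> max_form I p B z \<le> x" using p j1 by (auto simp: max_form_le_iff not_le)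
    with up show "z \<in> {z \<in> space (std_gaussian I). x < max_form I p B z \<and> max_form I p B z \<le> y}"
      using z by (auto simp: space_std_gaussian)
  qed
  then have "measure (std_gaussian I) (\<Pi>\<^sub>E i\<in>I. {e i - \<delta><..<e i + \<delta>}) \<le>
      measure (std_gaussian I) {z \<in> space (std_gaussian I). x < max_form I p B z \<and> max_form I p B z \<le> y}"
    using I by (intro finite_measure_mono) measurable
  with std_gaussian_box_pos[OF I \<delta>(1), of e] show ?thesis by linarith
qed

text \<open>
  The distribution function vanishes on the negative axis, is continuous since nonzero linear forms have no
  atoms, and increases strictly on the positive axis.
\<close>

lemma max_form_quantile:
  assumes I: "finite I" and j0: "j0 < p" and i0: "i0 \<in> I" "B j0 i0 \<noteq> 0" and q: "0 < q" "q < 1"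
  shows "\<exists>!x. measure (std_gaussian I) {z \<in> space (std_gaussian I). max_form I p B z \<le> x} = q"
proof -
  interpret prob_space "std_gaussian I" by (rule prob_space_std_gaussian)
  have p: "p > 0" using j0 by simp
  note [measurable] = measurable_max_form[OF I]
  let ?D = "distr (std_gaussian I) borel (max_form I p B)"
  interpret D: real_distribution ?D by (rule real_distribution_distr) measurable
  have cdf: "cdf ?D x = measure (std_gaussian I) {z \<in> space (std_gaussian I). max_form I p B z \<le> x}" for x
    unfolding cdf_def by (subst measure_distr) (auto intro!: arg_cong[where f="measure _"])
  have nonneg: "0 \<le> max_form I p B z" for z
    using max_form_attained[OF p, of I B z] by auto
  have cont: "isCont (cdf ?D) x" for x
  proof -
    let ?N = "\<lambda>j. {z \<in> space (std_gaussian I). (\<Sum>i\<in>I. B j i * z i) = x} \<union> {z \<in> space (std_gaussian I). (\<Sum>i\<in>I. B j i * z i) = - x}"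
    \<comment> \<open>forms with all coefficients zero have an atom at 0, but they attain the maximum only if the nonzero form \<open>j0\<close> vanishes too\<close>
    define J where "J = {j. j < p \<and> (\<exists>i\<in>I. B j i \<noteq> 0)}"
    have "measure ?D {x} = measure (std_gaussian I) {z \<in> space (std_gaussian I). max_form I p B z = x}"
      by (subst measure_distr) (auto intro!: arg_cong[where f="measure _"])
    also have "\<dots> \<le> measure (std_gaussian I) (\<Union>j\<in>J. ?N j)"
    proof (rule finite_measure_mono)
      show "{z \<in> space (std_gaussian I). max_form I p B z = x} \<subseteq> (\<Union>j\<in>J. ?N j)"
      proof
        fix z assume z: "z \<in> {z \<in> space (std_gaussian I). max_form I p B z = x}"
        obtain j where j: "j < p" "x = \<bar>\<Sum>i\<in>I. B j i * z i\<bar>"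
          using max_form_attained[OF p, of I B z] z by auto
        show "z \<in> (\<Union>j\<in>J. ?N j)"
        proof (cases "x = 0")
          case True
          then have "\<bar>\<Sum>i\<in>I. B j0 i * z i\<bar> \<le> 0"
            using z max_form_le_iff[OF p, of I B z 0] j0 by auto
          then show ?thesis using z j0 i0 True by (auto simp: J_def)
        next
          case False
          then have "\<exists>i\<in>I. B j i \<noteq> 0" using j by (force intro: sum.neutral)
          with j have "j \<in> J" by (simp add: J_def)
          moreover have "z \<in> ?N j" using z j by (auto simp: abs_if split: if_splits)
          ultimately show ?thesis by blast
        qed
      qed
      show "(\<Union>j\<in>J. ?N j) \<in> sets (std_gaussian I)"
        unfolding J_def by measurable
    qed
    also have "\<dots> \<le> (\<Sum>j\<in>J. measure (std_gaussian I) (?N j))"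
      unfolding J_def by (intro measure_UNION_le) auto
    also have "\<dots> \<le> (\<Sum>j\<in>J. 0)"
    proof (rule sum_mono)
      fix j assume "j \<in> J"
      then obtain i where i: "i \<in> I" "B j i \<noteq> 0" by (auto simp: J_def)
      have "measure (std_gaussian I) (?N j) \<le> measure (std_gaussian I) {z \<in> space (std_gaussian I). (\<Sum>i\<in>I. B j i * z i) = x}
          + measure (std_gaussian I) {z \<in> space (std_gaussian I). (\<Sum>i\<in>I. B j i * z i) = - x}"
        by (intro measure_Un_le) auto
      then show "measure (std_gaussian I) (?N j) \<le> 0"
        using std_gaussian_level_set_null[OF I i(1), of "B j"] i(2) by simp
    qed
    finally have "measure ?D {x} = 0" by (simp add: measure_le_0_iff)
    then show ?thesis by (simp add: D.isCont_cdf)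
  qed
  have neg: "cdf ?D x = 0" if "x < 0" for x
  proof -
    have "{z \<in> space (std_gaussian I). max_form I p B z \<le> x} = {}"
      using that nonneg by (auto simp: not_le intro: less_le_trans)
    then show ?thesis unfolding cdf by (simp only: measure_empty)
  qed
  have "\<exists>x. cdf ?D x = q"
  proof -
    have "eventually (\<lambda>x. q < cdf ?D x) at_top"
      by (rule order_tendstoD(1)[OF D.cdf_lim_at_top_prob q(2)])
    then obtain b where b: "q < cdf ?D b" by (auto simp: eventually_at_top_linorder)
    have "cdf ?D (-1) = 0" by (rule neg) simp
    moreover have "-1 \<le> b"
      using neg[of b] b q by (cases "b < 0") auto
    ultimately show ?thesis
      using IVT[of "cdf ?D" "-1" q b] b q cont by auto
  qed
  moreover have False if x: "cdf ?D x = q" and y: "cdf ?D y = q" and xy: "x < y" for x y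
  proof -
    have "0 \<le> x" using neg[of x] x q by (auto simp: not_less[symmetric])
    have "cdf ?D y - cdf ?D x = measure ?D {x<..y}"
      using D.cdf_diff_eq[OF xy] by simp
    also have "\<dots> = measure (std_gaussian I) {z \<in> space (std_gaussian I). x < max_form I p B z \<and> max_form I p B z \<le> y}"
      by (subst measure_distr) (auto intro!: arg_cong[where f="measure _"])
    finally show False
      using max_form_interval_pos[of I j0 p i0 B x y] I j0 i0 \<open>0 \<le> x\<close> xy x y by simp
  qed
  ultimately show ?thesis
    unfolding cdf[symmetric] by (metis linorder_neqE_linordered_idom)
qed


section \<open>Correlation of Gaussian vectors\<close>

text \<open>
  Given the vector \<open>v\<close> of the coordinates \<open>(True, i)\<close>, the inner product of an independent standard Gaussian vector with \<open>v / \<parallel>v\<parallel>\<close> is standard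
  normal.  For \<open>v = 0\<close> the inequality in the event is trivially true, but this has probability zero.
\<close>

lemma self_normalized_tail:
  fixes n :: nat
  assumes n: "n > 0" and s: "0 \<le> s"
  defines "J \<equiv> UNIV \<times> {..<n} :: (bool \<times> nat) set"
  shows "measure (std_gaussian J) {z \<in> space (std_gaussian J).
      s * sqrt (\<Sum>i<n. (z (True, i))\<^sup>2) \<le> \<bar>\<Sum>i<n. z (False, i) * z (True, i)\<bar>} \<le> 2 * exp (- s\<^sup>2 / 2)"
proof -
  interpret S: prob_space std_normal_distribution by (rule prob_space_std_normal)
  interpret product_sigma_finite "\<lambda>_. std_normal_distribution" ..
  define V where "V = {True} \<times> {..<n}"
  define W where "W = {False} \<times> {..<n}"
  have fin [simp]: "finite V" "finite W" by (auto simp: V_def W_def)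
  have VW: "V \<inter> W = {}" "V \<union> W = J" by (auto simp: V_def W_def J_def)
  have mem: "\<And>i. i < n \<Longrightarrow> (True, i) \<in> V" "\<And>i. i < n \<Longrightarrow> (False, i) \<in> W"
    "\<And>i. i < n \<Longrightarrow> (True, i) \<in> J" "\<And>i. i < n \<Longrightarrow> (False, i) \<in> J"
    by (auto simp: V_def W_def J_def)
  note [measurable] = mem
  interpret P: prob_space "std_gaussian J" by (rule prob_space_std_gaussian)
  interpret PV: prob_space "std_gaussian V" by (rule prob_space_std_gaussian)
  interpret PW: prob_space "std_gaussian W" by (rule prob_space_std_gaussian)
  define E where "E v w \<longleftrightarrow> s * sqrt (\<Sum>i<n. (v (True, i))\<^sup>2) \<le> \<bar>\<Sum>i<n. w (False, i) * v (True, i)\<bar>"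
    for v w :: "bool \<times> nat \<Rightarrow> real"
  have [measurable]: "{u \<in> space (std_gaussian V \<Otimes>\<^sub>M std_gaussian W). E (fst u) (snd u)} \<in> sets (std_gaussian V \<Otimes>\<^sub>M std_gaussian W)"
    unfolding E_def using mem(1,2) by measurable
  have [measurable]: "{z \<in> space (std_gaussian J). E z z} \<in> sets (std_gaussian J)"
    unfolding E_def using mem(3,4) by measurable
  have fibre: "AE v in std_gaussian V. emeasure (std_gaussian W) {w \<in> space (std_gaussian W). E v w} \<le> ennreal (2 * exp (- s\<^sup>2 / 2))"
  proof -
    have "AE v in std_gaussian V. v (True, 0) \<noteq> 0"
    proof (rule AE_I)
      show "{v \<in> space (std_gaussian V). \<not> v (True, 0) \<noteq> 0} \<subseteq> {v \<in> space (std_gaussian V). (\<Sum>i\<in>V. (if i = (True, 0) then 1 else 0) * v i) = 0}"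
        using mem(1)[OF n] by (auto simp: if_distrib[of "\<lambda>c. c * _"] cong: if_cong)
      show "emeasure (std_gaussian V) {v \<in> space (std_gaussian V). (\<Sum>i\<in>V. (if i = (True, 0) then 1 else 0) * v i) = 0} = 0"
        using std_gaussian_level_set_null[OF fin(1) mem(1)[OF n], of "\<lambda>i. if i = (True, 0) then 1 else 0" 0]
        by (simp add: PV.emeasure_eq_measure)
    qed measurable
    then show ?thesis
    proof eventually_elim
      case (elim v)
      define N where "N = sqrt (\<Sum>i<n. (v (True, i))\<^sup>2)"
      have sum_pos: "0 < (\<Sum>i<n. (v (True, i))\<^sup>2)"
        using elim n by (intro sum_pos2[of _ 0]) auto
      then have N: "N > 0" "N\<^sup>2 = (\<Sum>i<n. (v (True, i))\<^sup>2)" by (auto simp: N_def)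
      have sumW: "(\<Sum>i\<in>W. f i) = (\<Sum>i<n. f (False, i))" for f :: "bool \<times> nat \<Rightarrow> real"
        unfolding W_def by (rule sum.reindex_bij_witness[of _ "\<lambda>i. (False, i)" snd]) auto
      define b where "b i = v (True, snd i) / N" for i :: "bool \<times> nat"
      have unit: "(\<Sum>i\<in>W. (b i)\<^sup>2) = 1"
        using sum_pos by (simp add: sumW b_def power_divide sum_divide_distrib[symmetric] N(2))
      have "E v w \<longleftrightarrow> s \<le> \<bar>\<Sum>i\<in>W. b i * w i\<bar>" for w
      proof -
        have "(\<Sum>i\<in>W. b i * w i) = (\<Sum>i<n. w (False, i) * v (True, i)) / N"
          by (simp add: sumW b_def sum_divide_distrib mult.commute)
        then have "\<bar>\<Sum>i\<in>W. b i * w i\<bar> = \<bar>\<Sum>i<n. w (False, i) * v (True, i)\<bar> / N"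
          using N(1) by simp
        then show ?thesis using N(1) by (simp add: E_def N_def[symmetric] pos_le_divide_eq)
      qed
      then show ?case
        using std_gaussian_tail[OF fin(2) unit s] by (simp add: PW.emeasure_eq_measure)
    qed
  qed
  have "emeasure (std_gaussian J) {z \<in> space (std_gaussian J). E z z} =
      emeasure (distr (std_gaussian V \<Otimes>\<^sub>M std_gaussian W) (std_gaussian J) (merge V W)) {z \<in> space (std_gaussian J). E z z}"
    using distr_merge[OF VW(1) fin] by (simp add: VW(2))
  also have "\<dots> = emeasure (std_gaussian V \<Otimes>\<^sub>M std_gaussian W)
      (merge V W -` {z \<in> space (std_gaussian J). E z z} \<inter> space (std_gaussian V \<Otimes>\<^sub>M std_gaussian W))"
    using measurable_merge[of V W "\<lambda>_. std_normal_distribution"] by (subst emeasure_distr) (auto simp: VW(2))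
  also have "merge V W -` {z \<in> space (std_gaussian J). E z z} \<inter> space (std_gaussian V \<Otimes>\<^sub>M std_gaussian W) =
      {u \<in> space (std_gaussian V \<Otimes>\<^sub>M std_gaussian W). E (fst u) (snd u)}"
  proof -
    have "E (merge V W u) (merge V W u) = E (fst u) (snd u)" for u
      using mem(1,2) VW(1) by (cases u) (simp add: E_def)
    moreover have "merge V W u \<in> space (std_gaussian J)" if "u \<in> space (std_gaussian V \<Otimes>\<^sub>M std_gaussian W)" for u
      using measurable_space[OF measurable_merge[of V W "\<lambda>_. std_normal_distribution"] that] by (simp add: VW(2))
    ultimately show ?thesis by auto
  qed
  also have "emeasure (std_gaussian V \<Otimes>\<^sub>M std_gaussian W) \<dots> =
      (\<integral>\<^sup>+v. emeasure (std_gaussian W) (Pair v -` {u \<in> space (std_gaussian V \<Otimes>\<^sub>M std_gaussian W). E (fst u) (snd u)}) \<partial>std_gaussian V)"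
    by (rule PW.emeasure_pair_measure_alt) measurable
  also have "\<dots> = (\<integral>\<^sup>+v. emeasure (std_gaussian W) {w \<in> space (std_gaussian W). E v w} \<partial>std_gaussian V)"
    by (intro nn_integral_cong arg_cong[where f="emeasure _"]) (auto simp: space_pair_measure)
  also have "\<dots> \<le> (\<integral>\<^sup>+v. ennreal (2 * exp (- s\<^sup>2 / 2)) \<partial>std_gaussian V)"
    by (rule nn_integral_mono_AE) (rule fibre)
  also have "\<dots> = ennreal (2 * exp (- s\<^sup>2 / 2))"
    by (simp add: PV.emeasure_space_1)
  finally show ?thesis
    by (simp add: E_def P.emeasure_eq_measure)
qed

text \<open>
  \<open>U\<close> and \<open>V\<close> are standard Gaussian vectors in \<open>\<real>\<^sup>n\<close> whose entries have correlation \<open>\<rho>\<close>.  The vector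
  \<open>(U - \<rho> V) / sqrt (1 - \<rho>\<^sup>2)\<close> is standard Gaussian and independent of \<open>V\<close>, so the absolute value of the
  inner product of \<open>U\<close> with \<open>V / \<parallel>V\<parallel>\<close> exceeds that of a standard normal variable by at most
  \<open>\<bar>\<rho>\<bar> \<parallel>V\<parallel>\<close>, and this is at most \<open>\<bar>\<rho>\<bar> sqrt K\<close> on the event.
\<close>

lemma correlated_tail:
  fixes a b :: "nat \<Rightarrow> 'i \<Rightarrow> real"
  assumes I: "finite I" and n: "n > 0" and s: "0 \<le> s" and K: "0 < K" and \<rho>: "\<rho>\<^sup>2 < 1"
    and aa: "\<And>i k. i < n \<Longrightarrow> k < n \<Longrightarrow> (\<Sum>m\<in>I. a i m * a k m) = (if i = k then 1 else 0)"
    and bb: "\<And>i k. i < n \<Longrightarrow> k < n \<Longrightarrow> (\<Sum>m\<in>I. b i m * b k m) = (if i = k then 1 else 0)"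
    and ab: "\<And>i k. i < n \<Longrightarrow> k < n \<Longrightarrow> (\<Sum>m\<in>I. a i m * b k m) = (if i = k then \<rho> else 0)"
  defines "U \<equiv> \<lambda>z i. \<Sum>m\<in>I. a i m * z m" and "V \<equiv> \<lambda>z i. \<Sum>m\<in>I. b i m * z m"
  shows "measure (std_gaussian I) {z \<in> space (std_gaussian I).
      (s + \<bar>\<rho>\<bar> * sqrt K) * sqrt (\<Sum>i<n. (V z i)\<^sup>2) \<le> \<bar>\<Sum>i<n. U z i * V z i\<bar> \<and> (\<Sum>i<n. (V z i)\<^sup>2) \<le> K}
    \<le> 2 * exp (- s\<^sup>2 / 2)"
proof -
  interpret P: prob_space "std_gaussian I" by (rule prob_space_std_gaussian)
  define J where "J = (UNIV \<times> {..<n} :: (bool \<times> nat) set)"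
  interpret PJ: prob_space "std_gaussian J" by (rule prob_space_std_gaussian)
  define r where "r = sqrt (1 - \<rho>\<^sup>2)"
  have r: "r > 0" "r\<^sup>2 = 1 - \<rho>\<^sup>2" using \<rho> by (auto simp: r_def)
  have r1: "r \<le> 1" unfolding r_def by simp
  \<comment> \<open>coordinates \<open>(True, i)\<close> carry \<open>V\<close>, and \<open>(False, i)\<close> the part of \<open>U\<close> orthogonal to \<open>V\<close>\<close>
  define A where "A m = (if fst m then b (snd m) else (\<lambda>l. (a (snd m) l - \<rho> * b (snd m) l) / r))" for m :: "bool \<times> nat"
  have ba: "(\<Sum>m\<in>I. b i m * a k m) = (if i = k then \<rho> else 0)" if "i < n" "k < n" for i k
    using ab[OF that(2,1)] by (simp add: mult.commute)
  have orth: "(\<Sum>l\<in>I. A m l * A k l) = (if m = k then 1 else 0)" if "m \<in> J" "k \<in> J" for m k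
  proof -
    obtain m1 i where m: "m = (m1, i)" by (rule prod.exhaust)
    obtain k1 j where k: "k = (k1, j)" by (rule prod.exhaust)
    have mk: "m = (m1, i)" "k = (k1, j)" "i < n" "j < n"
      using that m k by (auto simp: J_def)
    have "(\<Sum>l\<in>I. (a i l - \<rho> * b i l) / r * ((a j l - \<rho> * b j l) / r)) =
        (\<Sum>l\<in>I. (a i l * a j l - \<rho> * (a i l * b j l) - \<rho> * (b i l * a j l) + \<rho>\<^sup>2 * (b i l * b j l)) / r\<^sup>2)"
      unfolding times_divide_times_eq power2_eq_square
      by (intro sum.cong refl arg_cong[where f="\<lambda>u. u / (r * r)"]) (simp add: algebra_simps)
    also have "\<dots> = ((\<Sum>l\<in>I. a i l * a j l) - \<rho> * (\<Sum>l\<in>I. a i l * b j l) - \<rho> * (\<Sum>l\<in>I. b i l * a j l) + \<rho>\<^sup>2 * (\<Sum>l\<in>I. b i l * b j l)) / r\<^sup>2"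
      by (simp only: sum_divide_distrib[symmetric] sum.distrib sum_subtractf sum_distrib_left[symmetric])
    finally have 1: "(\<Sum>l\<in>I. (a i l - \<rho> * b i l) / r * ((a j l - \<rho> * b j l) / r)) = (if i = j then 1 else 0)"
      using mk(3,4) \<rho> by (simp add: aa bb ab ba r(2)) (simp add: power2_eq_square)
    have "(\<Sum>l\<in>I. b i l * ((a j l - \<rho> * b j l) / r)) = (\<Sum>l\<in>I. (b i l * a j l - \<rho> * (b i l * b j l)) / r)"
      by (intro sum.cong refl) (simp add: algebra_simps)
    also have "\<dots> = ((\<Sum>l\<in>I. b i l * a j l) - \<rho> * (\<Sum>l\<in>I. b i l * b j l)) / r"
      by (simp only: sum_divide_distrib[symmetric] sum_subtractf sum_distrib_left[symmetric])
    finally have 2: "(\<Sum>l\<in>I. b i l * ((a j l - \<rho> * b j l) / r)) = 0"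
      using mk(3,4) by (simp add: bb ba)
    have "(\<Sum>l\<in>I. (a i l - \<rho> * b i l) / r * b j l) = (\<Sum>l\<in>I. (a i l * b j l - \<rho> * (b i l * b j l)) / r)"
      by (intro sum.cong refl) (simp add: algebra_simps)
    also have "\<dots> = ((\<Sum>l\<in>I. a i l * b j l) - \<rho> * (\<Sum>l\<in>I. b i l * b j l)) / r"
      by (simp only: sum_divide_distrib[symmetric] sum_subtractf sum_distrib_left[symmetric])
    finally have 3: "(\<Sum>l\<in>I. (a i l - \<rho> * b i l) / r * b j l) = 0"
      using mk(3,4) by (simp add: bb ab)
    show ?thesis
      using 1 2 3 bb[OF mk(3,4)] by (cases m1; cases k1) (simp_all add: A_def mk(1,2))
  qed
  define T where "T z = (\<lambda>m\<in>J. \<Sum>l\<in>I. A m l * z l)" for z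
  have finJ: "finite J" by (simp add: J_def)
  have T_meas [measurable]: "T \<in> measurable (std_gaussian I) (\<Pi>\<^sub>M m\<in>J. borel)"
    unfolding T_def by measurable
  have law: "distr (std_gaussian I) (\<Pi>\<^sub>M m\<in>J. borel) T = std_gaussian J"
    unfolding T_def using I finJ orth by (rule orthonormal_image_std_gaussian)
  have TV: "T z (True, i) = V z i" if "i < n" for z i
    using that by (simp add: T_def J_def A_def V_def)
  have TU: "U z i = \<rho> * V z i + r * T z (False, i)" if "i < n" for z i
  proof -
    have "T z (False, i) = (U z i - \<rho> * V z i) / r"
      using that by (simp add: T_def J_def A_def V_def U_def sum_subtractf sum_distrib_left sum_divide_distrib left_diff_distrib diff_divide_distrib mult.assoc)
    then show ?thesis using r by (simp add: field_simps)
  qed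
  let ?E = "{v \<in> space (std_gaussian J). s * sqrt (\<Sum>i<n. (v (True, i))\<^sup>2) \<le> \<bar>\<Sum>i<n. v (False, i) * v (True, i)\<bar>}"
  have E: "?E \<in> sets (\<Pi>\<^sub>M m\<in>J. borel)"
  proof -
    have [measurable]: "\<And>i b. i < n \<Longrightarrow> (b, i) \<in> J" by (auto simp: J_def)
    have "?E \<in> sets (std_gaussian J)" by measurable
    then show ?thesis by (simp add: sets_std_gaussian)
  qed
  have sub: "{z \<in> space (std_gaussian I). (s + \<bar>\<rho>\<bar> * sqrt K) * sqrt (\<Sum>i<n. (V z i)\<^sup>2) \<le> \<bar>\<Sum>i<n. U z i * V z i\<bar> \<and> (\<Sum>i<n. (V z i)\<^sup>2) \<le> K}
      \<subseteq> T -` ?E \<inter> space (std_gaussian I)"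
  proof
    fix z assume z: "z \<in> {z \<in> space (std_gaussian I). (s + \<bar>\<rho>\<bar> * sqrt K) * sqrt (\<Sum>i<n. (V z i)\<^sup>2) \<le> \<bar>\<Sum>i<n. U z i * V z i\<bar> \<and> (\<Sum>i<n. (V z i)\<^sup>2) \<le> K}"
    define Q where "Q = (\<Sum>i<n. (V z i)\<^sup>2)"
    define H where "H = (\<Sum>i<n. T z (False, i) * V z i)"
    have Q: "0 \<le> Q" "Q \<le> K" using z by (auto simp: Q_def intro: sum_nonneg)
    have "(\<Sum>i<n. U z i * V z i) = \<rho> * Q + r * H"
      by (simp add: Q_def H_def TU sum_distrib_left sum.distrib[symmetric] algebra_simps power2_eq_square)
    then have "(s + \<bar>\<rho>\<bar> * sqrt K) * sqrt Q \<le> \<bar>\<rho> * Q + r * H\<bar>" using z by (simp add: Q_def)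
    also have "\<dots> \<le> \<bar>\<rho>\<bar> * Q + r * \<bar>H\<bar>"
      using abs_triangle_ineq[of "\<rho> * Q" "r * H"] Q r by (simp add: abs_mult)
    also have "\<dots> \<le> \<bar>\<rho>\<bar> * (sqrt K * sqrt Q) + 1 * \<bar>H\<bar>"
    proof (intro add_mono mult_left_mono mult_right_mono r1)
      have "Q = sqrt Q * sqrt Q" using Q by simp
      also have "\<dots> \<le> sqrt K * sqrt Q" using Q by (intro mult_right_mono) auto
      finally show "Q \<le> sqrt K * sqrt Q" .
    qed auto
    finally have "s * sqrt Q \<le> \<bar>H\<bar>" by (simp add: algebra_simps)
    moreover have "T z \<in> space (std_gaussian J)"
      by (auto simp: T_def space_std_gaussian)
    ultimately show "z \<in> T -` ?E \<inter> space (std_gaussian I)"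
      using z by (simp add: Q_def H_def TV)
  qed
  have "measure (std_gaussian I) {z \<in> space (std_gaussian I). (s + \<bar>\<rho>\<bar> * sqrt K) * sqrt (\<Sum>i<n. (V z i)\<^sup>2) \<le> \<bar>\<Sum>i<n. U z i * V z i\<bar> \<and> (\<Sum>i<n. (V z i)\<^sup>2) \<le> K}
      \<le> measure (std_gaussian I) (T -` ?E \<inter> space (std_gaussian I))"
    using sub measurable_sets[OF T_meas E] by (rule P.finite_measure_mono)
  also have "\<dots> = measure (std_gaussian J) ?E"
    by (subst measure_distr[OF T_meas E, symmetric]) (simp only: law)
  also have "\<dots> \<le> 2 * exp (- s\<^sup>2 / 2)"
    unfolding J_def by (rule self_normalized_tail[OF n s])
  finally show ?thesis .
qed

lemma std_normal_second_moment:
  "integrable std_normal_distribution (\<lambda>x. x\<^sup>2)" "(\<integral>x. x\<^sup>2 \<partial>std_normal_distribution) = 1"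
  using std_normal_distribution_even_moments[of 1] by (simp_all add: eval_nat_numeral)

text \<open>
  Markov's inequality is enough here because the bound is used with a factor \<open>L\<close> that tends to infinity.
\<close>

lemma orthonormal_norm_tail:
  fixes b :: "nat \<Rightarrow> 'i \<Rightarrow> real"
  assumes I: "finite I" and L: "0 < L" and n: "n > 0"
    and b: "\<And>i. i < n \<Longrightarrow> (\<Sum>m\<in>I. (b i m)\<^sup>2) = 1"
  shows "measure (std_gaussian I) {z \<in> space (std_gaussian I). real n * L \<le> (\<Sum>i<n. (\<Sum>m\<in>I. b i m * z m)\<^sup>2)} \<le> 1 / L"
proof -
  interpret P: prob_space "std_gaussian I" by (rule prob_space_std_gaussian)
  have int: "integrable (std_gaussian I) (\<lambda>z. (\<Sum>m\<in>I. b i m * z m)\<^sup>2)"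
    and val: "(\<integral>z. (\<Sum>m\<in>I. b i m * z m)\<^sup>2 \<partial>std_gaussian I) = 1" if "i < n" for i
  proof -
    have m: "(\<lambda>z. \<Sum>m\<in>I. b i m * z m) \<in> borel_measurable (std_gaussian I)" by measurable
    note law = std_gaussian_linear_form_std_normal[OF I b[OF that]]
    show "integrable (std_gaussian I) (\<lambda>z. (\<Sum>m\<in>I. b i m * z m)\<^sup>2)"
      using std_normal_second_moment(1) m by (subst (asm) law[symmetric], subst (asm) integrable_distr_eq) auto
    show "(\<integral>z. (\<Sum>m\<in>I. b i m * z m)\<^sup>2 \<partial>std_gaussian I) = 1"
      using std_normal_second_moment(2) m by (subst (asm) law[symmetric], subst (asm) integral_distr) auto
  qed
  have "measure (std_gaussian I) {z \<in> space (std_gaussian I). real n * L \<le> (\<Sum>i<n. (\<Sum>m\<in>I. b i m * z m)\<^sup>2)}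
      \<le> (\<integral>z. (\<Sum>i<n. (\<Sum>m\<in>I. b i m * z m)\<^sup>2) \<partial>std_gaussian I) / (real n * L)"
    using n L int by (intro integral_Markov_inequality_measure[where A="space (std_gaussian I)"]) (auto intro!: sum_nonneg AE_I2)
  also have "(\<integral>z. (\<Sum>i<n. (\<Sum>m\<in>I. b i m * z m)\<^sup>2) \<partial>std_gaussian I) = real n"
    using int val by (subst Bochner_Integration.integral_sum) auto
  finally show ?thesis using n by simp
qed

section \<open>The statistic for zero estimates and its conditional law\<close>

lemma UNIV_population: "UNIV = {PopA, PopB}"
  using population.exhaust by auto

instance population :: finite
  by standard (simp add: UNIV_population)

text \<open>
  All the randomness of the two samples is collected in one vector indexed by triples \<open>(k, i, j)\<close>:
  coordinate \<open>j < p\<close> is the \<open>j\<close>-th regressor of observation \<open>i\<close> in population \<open>k\<close>, and the additional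
  coordinate \<open>j = p\<close> is its error.
\<close>

definition design_index :: "nat \<Rightarrow> nat \<Rightarrow> (population \<times> nat \<times> nat) set" where
  "design_index n p = UNIV \<times> {..<n} \<times> {..<p}"

definition error_index :: "nat \<Rightarrow> nat \<Rightarrow> (population \<times> nat \<times> nat) set" where
  "error_index n p = UNIV \<times> {..<n} \<times> {p}"

definition design :: "(population \<times> nat \<times> nat \<Rightarrow> real) \<Rightarrow> population \<Rightarrow> nat \<Rightarrow> nat \<Rightarrow> real" where
  "design z k i j = z (k, i, j)"

lemma finite_index [simp]: "finite (design_index n p)" "finite (error_index n p)"
  by (simp_all add: design_index_def error_index_def)

lemma disjoint_index: "design_index n p \<inter> error_index n p = {}"
  by (auto simp: design_index_def error_index_def)

lemma mem_index [simp]: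
  "(k, i, j) \<in> design_index n p \<longleftrightarrow> i < n \<and> j < p"
  "(k, i, j) \<in> error_index n p \<longleftrightarrow> i < n \<and> j = p"
  by (auto simp: design_index_def error_index_def)

lemma sum_error_index: "(\<Sum>m\<in>error_index n p. f m) = (\<Sum>i<n. f (PopA, i, p)) + (\<Sum>i<n. f (PopB, i, p))"
  for f :: "_ \<Rightarrow> real"
proof -
  have "(\<Sum>m\<in>error_index n p. f m) = (\<Sum>(k, i)\<in>UNIV \<times> {..<n}. f (k, i, p))"
    unfolding error_index_def
    by (rule sum.reindex_bij_witness[of _ "\<lambda>(k, i). (k, i, p)" "\<lambda>(k, i, j). (k, i)"]) auto
  then show ?thesis
    by (simp add: sum.cartesian_product[symmetric] UNIV_population)
qed

text \<open>
  Row \<open>j\<close> of the matrix by which the errors enter the difference of the two de-biased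
  estimators, scaled by \<open>sqrt n\<close>; hence the sign of the second population.
\<close>

definition noise_coef :: "nat \<Rightarrow> (population \<Rightarrow> nat \<Rightarrow> nat \<Rightarrow> real) \<Rightarrow> nat \<Rightarrow> population \<times> nat \<times> nat \<Rightarrow> real" where
  "noise_coef n X j m = (case m of (k, i, _) \<Rightarrow> (case k of PopA \<Rightarrow> 1 | PopB \<Rightarrow> - 1) * X k i j / sqrt (real n))"

lemma noise_coef_simps [simp]:
  "noise_coef n X j (PopA, i, l) = X PopA i j / sqrt (real n)"
  "noise_coef n X j (PopB, i, l) = - X PopB i j / sqrt (real n)"
  by (simp_all add: noise_coef_def)

abbreviation pooled_cov :: "nat \<Rightarrow> (population \<Rightarrow> nat \<Rightarrow> nat \<Rightarrow> real) \<Rightarrow> nat \<Rightarrow> nat \<Rightarrow> real" where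
  "pooled_cov n X j l \<equiv> sample_cov n (X PopA) j l + sample_cov n (X PopB) j l"

text \<open>
  This is the factorization of \<open>\<Sigma>\<^sub>A + \<Sigma>\<^sub>B\<close> that \<open>gaussian_affine\<close> asks for.
\<close>

lemma pooled_cov_eq:
  "pooled_cov n X j l = (\<Sum>m\<in>error_index n p. noise_coef n X j m * noise_coef n X l m)"
  by (simp add: sum_error_index sample_cov_def sum_divide_distrib)

text \<open>
  The value of the test statistic when both Lasso estimates are zero, as a function of the
  designs \<open>X\<close> and the errors \<open>e\<close>.
\<close>

definition zero_fit_stat ::
    "nat \<Rightarrow> nat \<Rightarrow> real \<Rightarrow> (population \<Rightarrow> nat \<Rightarrow> nat \<Rightarrow> real) \<Rightarrow> (population \<times> nat \<times> nat \<Rightarrow> real) \<Rightarrow> real" where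
  "zero_fit_stat n p c X e = (MAX j\<in>{..<p}.
     \<bar>(\<Sum>l<p. sample_cov n (X PopA) j l - sample_cov n (X PopB) j l) * c +
      (\<Sum>m\<in>error_index n p. noise_coef n X j m * e m)\<bar> / sqrt (pooled_cov n X j j))"

lemma sample_cov_cong: "(\<And>i. i < n \<Longrightarrow> X i j = X' i j) \<Longrightarrow> (\<And>i. i < n \<Longrightarrow> X i l = X' i l) \<Longrightarrow>
    sample_cov n X j l = sample_cov n X' j l"
  by (simp add: sample_cov_def)

lemma zero_fit_stat_cong:
  assumes "\<And>k i j. i < n \<Longrightarrow> j < p \<Longrightarrow> X k i j = X' k i j"
    and "\<And>m. m \<in> error_index n p \<Longrightarrow> e m = e' m"
  shows "zero_fit_stat n p c X e = zero_fit_stat n p c X' e'"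
proof -
  have cov: "sample_cov n (X k) j l = sample_cov n (X' k) j l" if "j < p" "l < p" for k j l
    using that assms(1) by (intro sample_cov_cong) auto
  have coef: "noise_coef n X j m = noise_coef n X' j m" if "j < p" "m \<in> error_index n p" for j m
    using that assms(1) by (auto simp: noise_coef_def error_index_def)
  show ?thesis
    unfolding zero_fit_stat_def
    by (intro arg_cong[where f=Max] image_cong refl) (simp add: cov coef assms(2))
qed

lemma measurable_zero_fit_stat:
  assumes [measurable]: "\<And>k i j. i < n \<Longrightarrow> j < p \<Longrightarrow> (\<lambda>x. X x k i j) \<in> borel_measurable M"
    and [measurable]: "\<And>m. m \<in> error_index n p \<Longrightarrow> (\<lambda>x. e x m) \<in> borel_measurable M"
  shows "(\<lambda>x. zero_fit_stat n p c (X x) (e x)) \<in> borel_measurable M"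
proof -
  have cov [measurable]: "(\<lambda>x. sample_cov n (X x k) j l) \<in> borel_measurable M" if "j < p" "l < p" for k j l
    unfolding sample_cov_def using that by measurable
  have coef [measurable]: "(\<lambda>x. noise_coef n (X x) j m) \<in> borel_measurable M" if "j < p" "m \<in> error_index n p" for j m
    using that by (cases m; cases "fst m") (auto simp: error_index_def)
  show ?thesis
    unfolding zero_fit_stat_def by measurable
qed

text \<open>
  At sample covariance matrices \<open>F_max\<close> is the conditional distribution function, given the designs, of
  the statistic for zero estimates.
\<close>

lemma F_max_design:
  "F_max p x c (sample_cov n (X PopA)) (sample_cov n (X PopB)) =
    measure (std_gaussian (error_index n p)) {e \<in> space (std_gaussian (error_index n p)). zero_fit_stat n p c X e \<le> x}"
proof -
  let ?\<mu> = "\<lambda>j. (\<Sum>l<p. sample_cov n (X PopA) j l - sample_cov n (X PopB) j l) * c"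
  let ?T = "\<lambda>z. \<lambda>j\<in>{..<p}. ?\<mu> j + (\<Sum>m\<in>error_index n p. noise_coef n X j m * z m)"
  have law: "gaussian p ?\<mu> (pooled_cov n X) = distr (std_gaussian (error_index n p)) (vec_space p) ?T"
    by (intro gaussian_affine pooled_cov_eq) simp
  have T: "?T \<in> measurable (std_gaussian (error_index n p)) (vec_space p)"
    by measurable
  have S: "{z \<in> space (vec_space p). (MAX j\<in>{..<p}. \<bar>z j\<bar> / sqrt (pooled_cov n X j j)) \<le> x} \<in> sets (vec_space p)"
    by measurable
  have stat: "(MAX j\<in>{..<p}. \<bar>?T z j\<bar> / sqrt (pooled_cov n X j j)) = zero_fit_stat n p c X z" for z
    unfolding zero_fit_stat_def by (intro arg_cong[where f=Max] image_cong refl) simp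
  have "F_max p x c (sample_cov n (X PopA)) (sample_cov n (X PopB)) =
    measure (std_gaussian (error_index n p)) (?T -` {z \<in> space (vec_space p). (MAX j\<in>{..<p}. \<bar>z j\<bar> / sqrt (pooled_cov n X j j)) \<le> x}
      \<inter> space (std_gaussian (error_index n p)))"
    unfolding F_max_def law space_distr by (rule measure_distr[OF T S])
  also have "?T -` {z \<in> space (vec_space p). (MAX j\<in>{..<p}. \<bar>z j\<bar> / sqrt (pooled_cov n X j j)) \<le> x}
      \<inter> space (std_gaussian (error_index n p)) = {e \<in> space (std_gaussian (error_index n p)). zero_fit_stat n p c X e \<le> x}"
    using measurable_space[OF T] by (auto simp only: stat vimage_def mem_Collect_eq Int_iff)
  finally show ?thesis .
qed

lemma F_max_design_mono:
  "x \<le> y \<Longrightarrow> F_max p x c (sample_cov n (X PopA)) (sample_cov n (X PopB)) \<le> F_max p y c (sample_cov n (X PopA)) (sample_cov n (X PopB))"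
proof -
  assume "x \<le> y"
  interpret prob_space "std_gaussian (error_index n p)" by (rule prob_space_std_gaussian)
  have [measurable]: "zero_fit_stat n p c X \<in> borel_measurable (std_gaussian (error_index n p))"
    by (rule measurable_zero_fit_stat) measurable
  show ?thesis
    unfolding F_max_design using \<open>x \<le> y\<close> by (intro finite_measure_mono) auto
qed

lemma F_max_design_cong:
  assumes "\<And>k i j. i < n \<Longrightarrow> j < p \<Longrightarrow> X k i j = X' k i j"
  shows "F_max p x c (sample_cov n (X PopA)) (sample_cov n (X PopB)) = F_max p x c (sample_cov n (X' PopA)) (sample_cov n (X' PopB))"
  unfolding F_max_design using zero_fit_stat_cong[OF assms refl] by simp

lemma crit_value_cong:
  assumes "\<And>k i j. i < n \<Longrightarrow> j < p \<Longrightarrow> X k i j = X' k i j"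
  shows "crit_value n p X \<alpha> = crit_value n p X' \<alpha>"
  unfolding crit_value_def F_max_inv_def using F_max_design_cong[of n p X X', OF assms] by simp

lemma pooled_cov_nonneg: "0 \<le> pooled_cov n X j j"
  unfolding sample_cov_def by (intro add_nonneg_nonneg divide_nonneg_nonneg sum_nonneg) auto

text \<open>
  For \<open>c = 0\<close> the statistic is a maximum of linear forms of the errors; forms with variance zero are
  absorbed because a division by zero yields zero.
\<close>

lemma F_max_quantile:
  assumes j: "j < p" and pos: "pooled_cov n X j j \<noteq> 0" and q: "0 < q" "q < 1"
  shows "\<exists>!x. F_max p x 0 (sample_cov n (X PopA)) (sample_cov n (X PopB)) = q"
proof -
  let ?B = "\<lambda>j m. noise_coef n X j m / sqrt (pooled_cov n X j j)"
  have "\<exists>m\<in>error_index n p. noise_coef n X j m \<noteq> 0"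
    using pos unfolding pooled_cov_eq[of n X j j p] by (metis (no_types, lifting) mult_zero_left sum.neutral)
  then obtain m where m: "m \<in> error_index n p" "?B j m \<noteq> 0"
    using pos by auto
  have "zero_fit_stat n p 0 X = max_form (error_index n p) p ?B"
    unfolding zero_fit_stat_def max_form_def
  proof (intro ext arg_cong[where f=Max] image_cong refl)
    fix e j
    show "\<bar>(\<Sum>l<p. sample_cov n (X PopA) j l - sample_cov n (X PopB) j l) * 0 + (\<Sum>m\<in>error_index n p. noise_coef n X j m * e m)\<bar> / sqrt (pooled_cov n X j j) =
        \<bar>\<Sum>m\<in>error_index n p. ?B j m * e m\<bar>"
      using pooled_cov_nonneg[of n X j] by (simp add: sum_divide_distrib[symmetric])
  qed
  then show ?thesis
    unfolding F_max_design using max_form_quantile[of "error_index n p" j p m ?B q] j m q by simp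
qed

text \<open>
  A description of the critical value by values of \<open>F_max\<close>, from which its measurability follows.
\<close>

lemma crit_value_le_iff:
  assumes j: "j < p" and pos: "pooled_cov n X j j \<noteq> 0" and \<alpha>: "0 < \<alpha>" "\<alpha> < 1"
  shows "crit_value n p X \<alpha> \<le> t \<longleftrightarrow> 1 - \<alpha> \<le> F_max p t 0 (sample_cov n (X PopA)) (sample_cov n (X PopB))"
proof -
  let ?F = "\<lambda>x. F_max p x 0 (sample_cov n (X PopA)) (sample_cov n (X PopB))"
  have ex: "\<exists>!x. ?F x = 1 - \<alpha>"
    using \<alpha> by (intro F_max_quantile[OF j pos]) auto
  then have "1 - \<alpha> \<in> range ?F" by (metis rangeI)
  then have crit: "?F (crit_value n p X \<alpha>) = 1 - \<alpha>"
    unfolding crit_value_def F_max_inv_def by (rule f_inv_into_f)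
  show ?thesis
  proof
    assume "crit_value n p X \<alpha> \<le> t"
    then show "1 - \<alpha> \<le> ?F t" using F_max_design_mono crit by metis
  next
    assume ge: "1 - \<alpha> \<le> ?F t"
    show "crit_value n p X \<alpha> \<le> t"
    proof (rule ccontr)
      assume less: "\<not> crit_value n p X \<alpha> \<le> t"
      then have "?F t \<le> ?F (crit_value n p X \<alpha>)" by (intro F_max_design_mono) simp
      with ge crit have "?F t = 1 - \<alpha>" by simp
      with ex crit less show False by auto
    qed
  qed
qed

text \<open>
  If all variances vanish the distribution function takes only the values \<open>0\<close> and \<open>1\<close>, and the
  critical value is an unspecified number.  It is the same number for all such designs, which makes
  the critical value measurable on this exceptional set as well.
\<close>

lemma crit_value_degenerate:
  assumes p: "p > 0" and zero: "\<And>j. j < p \<Longrightarrow> pooled_cov n X j j = 0" and \<alpha>: "0 < \<alpha>" "\<alpha> < 1"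
  shows "crit_value n p X \<alpha> = (SOME x. False)"
proof -
  interpret prob_space "std_gaussian (error_index n p)" by (rule prob_space_std_gaussian)
  have "zero_fit_stat n p 0 X e = 0" for e
  proof -
    have "zero_fit_stat n p 0 X e = (MAX j\<in>{..<p}. 0)"
      unfolding zero_fit_stat_def by (intro arg_cong[where f=Max] image_cong refl) (simp add: zero)
    then show ?thesis using p by (simp add: image_constant_conv lessThan_empty_iff)
  qed
  then have "F_max p x 0 (sample_cov n (X PopA)) (sample_cov n (X PopB)) \<in> {0, 1}" for x
    unfolding F_max_design by (cases "0 \<le> x") (simp_all add: prob_space)
  moreover have "1 - \<alpha> \<notin> {0, 1}" using \<alpha> by auto
  ultimately have "F_max p x 0 (sample_cov n (X PopA)) (sample_cov n (X PopB)) \<noteq> 1 - \<alpha>" for x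
    by metis
  then show ?thesis
    unfolding crit_value_def F_max_inv_def inv_into_def by simp
qed

text \<open>
  The threshold may depend on the argument as well, so that \<open>F_max\<close> can be evaluated at the critical value.
\<close>

lemma measurable_F_max_design:
  assumes X [measurable]: "\<And>k i j. i < n \<Longrightarrow> j < p \<Longrightarrow> (\<lambda>x. X x k i j) \<in> borel_measurable M"
    and t [measurable]: "t \<in> borel_measurable M"
  shows "(\<lambda>x. F_max p (t x) c (sample_cov n (X x PopA)) (sample_cov n (X x PopB))) \<in> borel_measurable M"
proof -
  let ?E = "std_gaussian (error_index n p)"
  interpret prob_space ?E by (rule prob_space_std_gaussian)
  let ?Q = "{u \<in> space (M \<Otimes>\<^sub>M ?E). zero_fit_stat n p c (X (fst u)) (snd u) \<le> t (fst u)}"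
  have "(\<lambda>u. zero_fit_stat n p c (X (fst u)) (snd u)) \<in> borel_measurable (M \<Otimes>\<^sub>M ?E)"
    by (rule measurable_zero_fit_stat) measurable
  then have Q: "?Q \<in> sets (M \<Otimes>\<^sub>M ?E)" by measurable
  have "(\<lambda>x. enn2real (emeasure ?E (Pair x -` ?Q))) \<in> borel_measurable M"
    using measurable_emeasure_Pair[OF Q] by measurable
  moreover have "enn2real (emeasure ?E (Pair x -` ?Q)) = F_max p (t x) c (sample_cov n (X x PopA)) (sample_cov n (X x PopB))"
    if "x \<in> space M" for x
    using that unfolding F_max_design measure_def
    by (intro arg_cong[where f=enn2real] arg_cong[where f="emeasure _"]) (auto simp: space_pair_measure)
  ultimately show ?thesis by (simp cong: measurable_cong)
qed

lemma measurable_crit_value: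
  assumes X [measurable]: "\<And>k i j. i < n \<Longrightarrow> j < p \<Longrightarrow> (\<lambda>x. X x k i j) \<in> borel_measurable M"
    and p: "p > 0" and \<alpha>: "0 < \<alpha>" "\<alpha> < 1"
  shows "(\<lambda>x. crit_value n p (X x) \<alpha>) \<in> borel_measurable M"
proof (rule borel_measurable_iff_le[THEN iffD2], rule allI)
  fix t
  have [measurable]: "(\<lambda>x. pooled_cov n (X x) j j) \<in> borel_measurable M" if "j < p" for j
    unfolding sample_cov_def using that by measurable
  have [measurable]: "(\<lambda>x. F_max p t 0 (sample_cov n (X x PopA)) (sample_cov n (X x PopB))) \<in> borel_measurable M"
    by (rule measurable_F_max_design) measurable
  have "crit_value n p (X x) \<alpha> \<le> t \<longleftrightarrow>
      (if \<exists>j\<in>{..<p}. pooled_cov n (X x) j j \<noteq> 0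
       then 1 - \<alpha> \<le> F_max p t 0 (sample_cov n (X x PopA)) (sample_cov n (X x PopB)) else (SOME x::real. False) \<le> t)" for x
  proof (cases "\<exists>j\<in>{..<p}. pooled_cov n (X x) j j \<noteq> 0")
    case True
    then obtain j where "j < p" "pooled_cov n (X x) j j \<noteq> 0" by auto
    from crit_value_le_iff[OF this \<alpha>] True show ?thesis by simp
  next
    case False
    then have "crit_value n p (X x) \<alpha> = (SOME x. False)"
      using p \<alpha> by (intro crit_value_degenerate) auto
    with False show ?thesis by simp
  qed
  then show "{x \<in> space M. crit_value n p (X x) \<alpha> \<le> t} \<in> sets M"
    by simp
qed

text \<open>
  Fubini's theorem for the designs and the errors: for fixed designs the critical value is a constant, and
  the statistic, a function of the errors, exceeds it with probability one minus its distribution function.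
\<close>

lemma rejection_probability_zero_fit:
  fixes n p :: nat
  assumes p: "p > 0" and \<alpha>: "0 < \<alpha>" "\<alpha> < 1"
  defines "N \<equiv> std_gaussian (design_index n p \<union> error_index n p)"
  shows "measure N {z \<in> space N. crit_value n p (design z) \<alpha> < zero_fit_stat n p c (design z) z} =
    (\<integral>z. 1 - F_max p (crit_value n p (design z) \<alpha>) c (sample_cov n (design z PopA)) (sample_cov n (design z PopB)) \<partial>N)"
proof -
  interpret S: prob_space std_normal_distribution by (rule prob_space_std_normal)
  interpret product_sigma_finite "\<lambda>_. std_normal_distribution" ..
  interpret N: prob_space N unfolding N_def by (rule prob_space_std_gaussian)
  let ?D = "design_index n p" and ?E = "error_index n p"
  interpret E: prob_space "std_gaussian ?E" by (rule prob_space_std_gaussian)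
  have X_meas: "(\<lambda>z. design z k i j) \<in> borel_measurable N" if "i < n" "j < p" for k i j
    unfolding design_def N_def by (rule measurable_component_singleton[THEN measurable_compose]) (use that in auto)
  have e_meas: "(\<lambda>z. z m) \<in> borel_measurable N" if "m \<in> ?E" for m
    unfolding N_def by (rule measurable_component_singleton[THEN measurable_compose]) (use that in auto)
  note [measurable] = measurable_crit_value[OF X_meas p \<alpha>] measurable_zero_fit_stat[OF X_meas e_meas]
    measurable_F_max_design[OF X_meas measurable_crit_value[OF X_meas p \<alpha>]]
  define A where "A = {z \<in> space N. crit_value n p (design z) \<alpha> < zero_fit_stat n p c (design z) z}"
  define f where "f z = 1 - F_max p (crit_value n p (design z) \<alpha>) c (sample_cov n (design z PopA)) (sample_cov n (design z PopB))" for z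
  have A [measurable]: "A \<in> sets N" unfolding A_def by measurable
  have f [measurable]: "f \<in> borel_measurable N" unfolding f_def by measurable
  have f_range: "0 \<le> f z" "f z \<le> 1" for z
    unfolding f_def F_max_design by (simp_all add: E.prob_le_1)
  have inner: "(\<integral>w. indicator A (merge ?D ?E (v, w)) \<partial>std_gaussian ?E) = (\<integral>w. f (merge ?D ?E (v, w)) \<partial>std_gaussian ?E)"
    if v: "v \<in> space (std_gaussian ?D)" for v
  proof -
    have D: "design (merge ?D ?E (v, w)) k i j = design v k i j" if "i < n" "j < p" for w k i j
      using that by (simp add: design_def merge_def)
    have W: "merge ?D ?E (v, w) m = w m" if "m \<in> ?E" for w m
      using that disjoint_index by (auto simp: merge_def)
    have crit: "crit_value n p (design (merge ?D ?E (v, w))) \<alpha> = crit_value n p (design v) \<alpha>" for w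
      by (rule crit_value_cong) (rule D)
    have stat: "zero_fit_stat n p c (design (merge ?D ?E (v, w))) (merge ?D ?E (v, w)) = zero_fit_stat n p c (design v) w" for w
      by (rule zero_fit_stat_cong) (simp_all add: D W)
    have f_v: "f (merge ?D ?E (v, w)) = f v" for w
      unfolding f_def crit using F_max_design_cong[OF D] by simp
    have "merge ?D ?E (v, w) \<in> space N" if "w \<in> space (std_gaussian ?E)" for w
      using measurable_space[OF measurable_merge[of ?D ?E "\<lambda>_. std_normal_distribution"], of "(v, w)"] v that
      by (simp add: N_def space_pair_measure)
    then have "(\<integral>w. indicator A (merge ?D ?E (v, w)) \<partial>std_gaussian ?E) =
        (\<integral>w. indicator {w \<in> space (std_gaussian ?E). \<not> zero_fit_stat n p c (design v) w \<le> crit_value n p (design v) \<alpha>} w \<partial>std_gaussian ?E)"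
      by (intro Bochner_Integration.integral_cong) (auto simp: indicator_def A_def crit stat)
    also have "\<dots> = measure (std_gaussian ?E) {w \<in> space (std_gaussian ?E). \<not> zero_fit_stat n p c (design v) w \<le> crit_value n p (design v) \<alpha>}"
      by (simp add: Int_absorb2 subset_eq)
    also have "\<dots> = f v"
    proof -
      have [measurable]: "zero_fit_stat n p c (design v) \<in> borel_measurable (std_gaussian ?E)"
        by (rule measurable_zero_fit_stat) measurable
      show ?thesis
        unfolding f_def F_max_design by (intro E.prob_neg) measurable
    qed
    finally show ?thesis by (simp add: f_v E.prob_space)
  qed
  have "measure N A = (\<integral>z. indicator A z \<partial>N)"
    by (simp add: Int_absorb2 A_def subset_eq)
  also have "\<dots> = (\<integral>v. (\<integral>w. indicator A (merge ?D ?E (v, w)) \<partial>std_gaussian ?E) \<partial>std_gaussian ?D)"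
    unfolding N_def using A by (intro product_integral_fold disjoint_index finite_index integrable_real_indicator)
      (auto simp: N_def[symmetric] N.emeasure_eq_measure)
  also have "\<dots> = (\<integral>v. (\<integral>w. f (merge ?D ?E (v, w)) \<partial>std_gaussian ?E) \<partial>std_gaussian ?D)"
    by (intro Bochner_Integration.integral_cong refl inner)
  also have "\<dots> = (\<integral>z. f z \<partial>N)"
    unfolding N_def using f f_range
    by (intro product_integral_fold[symmetric] disjoint_index finite_index)
       (auto simp: N_def[symmetric] intro!: N.integrable_const_bound[where B=1])
  finally show ?thesis unfolding A_def f_def .
qed

section \<open>The scaled Lasso estimates are zero with high probability\<close>

text \<open>
  With \<open>l = ln p\<close> this is a union bound over \<open>p\<close> Gaussian tails.  The shift \<open>C * sqrt (sqrt l)\<close> is of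
  smaller order than \<open>sqrt l\<close>, so an intermediate \<open>m\<close> between \<open>sqrt 2\<close> and \<open>lam\<close> absorbs it, and
  \<open>m\<^sup>2 / 2 > 1\<close> still gives exponential decay.
\<close>

lemma gaussian_union_bound_asymptotics:
  fixes lam C :: real
  assumes "lam > sqrt 2"
  shows "((\<lambda>l. exp l * exp (- (lam * sqrt l - C * sqrt (sqrt l))\<^sup>2 / 2)) \<longlongrightarrow> 0) at_top"
proof -
  define m where "m = (lam + sqrt 2) / 2"
  have m: "sqrt 2 < m" "m < lam" using assms by (auto simp: m_def)
  have "2 < m\<^sup>2" using power_strict_mono[OF m(1), of 2] by simp
  then have d: "m\<^sup>2 / 2 - 1 > 0" by simp
  have "filterlim (\<lambda>l::real. sqrt (sqrt l)) at_top at_top"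
    by (rule filterlim_compose[OF sqrt_at_top sqrt_at_top])
  then have "eventually (\<lambda>l. C / (lam - m) \<le> sqrt (sqrt l)) at_top"
    by (simp add: filterlim_at_top)
  then have "eventually (\<lambda>l. exp l * exp (- (lam * sqrt l - C * sqrt (sqrt l))\<^sup>2 / 2) \<le> exp (- ((m\<^sup>2 / 2 - 1) * l))) at_top"
    using eventually_ge_at_top[of 0]
  proof eventually_elim
    case (elim l)
    have "C \<le> (lam - m) * sqrt (sqrt l)"
      using elim m by (simp add: pos_divide_le_eq mult.commute)
    then have "C * sqrt (sqrt l) \<le> (lam - m) * sqrt (sqrt l) * sqrt (sqrt l)"
      using elim by (intro mult_right_mono) auto
    then have "m * sqrt l \<le> lam * sqrt l - C * sqrt (sqrt l)"
      using elim by (simp add: algebra_simps)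
    then have "(m * sqrt l)\<^sup>2 \<le> (lam * sqrt l - C * sqrt (sqrt l))\<^sup>2"
      using elim m by (intro power_mono mult_nonneg_nonneg) (auto intro: order_trans[of _ "sqrt 2"])
    then have "m\<^sup>2 * l \<le> (lam * sqrt l - C * sqrt (sqrt l))\<^sup>2"
      using elim by (simp add: power_mult_distrib)
    moreover have "(m\<^sup>2 / 2 - 1) * l = m\<^sup>2 * l / 2 - l"
      by (simp add: left_diff_distrib)
    ultimately show ?case
      unfolding mult_exp_exp exp_le_cancel_iff by linarith
  qed
  moreover have "((\<lambda>l. exp (- ((m\<^sup>2 / 2 - 1) * l))) \<longlongrightarrow> 0) at_top"
    using d by real_asymp
  ultimately show ?thesis
    by (rule tendsto_sandwich[OF _ _ tendsto_const, rotated]) auto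
qed

text \<open>
  Minimizing over the scale replaces the loss by \<open>\<parallel>y - X b\<parallel> / sqrt n + lam * \<parallel>b\<parallel>\<^sub>1\<close>, and \<open>\<parallel>y - X b\<parallel>\<close> is at
  least the inner product of \<open>y - X b\<close> with \<open>y / \<parallel>y\<parallel>\<close>.  If all correlations of the columns with \<open>y\<close> are smaller
  than the penalty level, any nonzero \<open>b\<close> loses more in the penalty than it gains in the fit.
\<close>

lemma scaled_lasso_zero:
  assumes n: "n > 0"
    and lasso: "is_scaled_lasso n p lam X y b s"
    and small: "\<And>j. j < p \<Longrightarrow> \<bar>\<Sum>i<n. X i j * y i\<bar> < lam * sqrt (real n) * sqrt (\<Sum>i<n. (y i)\<^sup>2)"
    and j: "j < p"
  shows "b j = 0"
proof (rule ccontr)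
  assume nz: "b j \<noteq> 0"
  define N where "N = sqrt (\<Sum>i<n. (y i)\<^sup>2)"
  define R where "R = sqrt (\<Sum>i<n. (residual p X y b i)\<^sup>2)"
  define g where "g j = (\<Sum>i<n. X i j * y i)" for j
  have R2: "R\<^sup>2 = (\<Sum>i<n. (residual p X y b i)\<^sup>2)" "0 \<le> R"
    unfolding R_def by (auto intro!: sum_nonneg real_sqrt_pow2)
  have N2: "N\<^sup>2 = (\<Sum>i<n. (y i)\<^sup>2)" "0 \<le> N"
    unfolding N_def by (auto intro!: sum_nonneg real_sqrt_pow2)
  have sn: "sqrt (real n) > 0" "(sqrt (real n))\<^sup>2 = real n" using n by auto
  have "N \<noteq> 0"
  proof
    assume "N = 0"
    then show False using small[OF j] by (simp add: N_def)
  qed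
  with N2 have N: "N > 0" by simp
  have dom: "(b, s) \<in> scaled_lasso_dom n p X y"
    and min: "\<And>b' s'. (b', s') \<in> scaled_lasso_dom n p X y \<Longrightarrow>
      scaled_lasso_loss n p lam X y b s \<le> scaled_lasso_loss n p lam X y b' s'"
    using lasso by (auto simp: is_scaled_lasso_def)
  have lower: "R / sqrt (real n) + lam * (\<Sum>j<p. \<bar>b j\<bar>) \<le> scaled_lasso_loss n p lam X y b s"
  proof (cases "s > 0")
    case True
    have "0 \<le> (R / sqrt (real n) - s)\<^sup>2" by simp
    also have "\<dots> = R\<^sup>2 / real n + s\<^sup>2 - 2 * s * (R / sqrt (real n))"
      using sn by (simp add: power2_diff power_divide)
    finally have "R / sqrt (real n) \<le> (R\<^sup>2 / real n + s\<^sup>2) / (2 * s)"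
      using True by (simp add: pos_le_divide_eq mult.commute)
    also have "\<dots> = R\<^sup>2 / (2 * real n * s) + s / 2"
      using True n by (simp add: field_simps power2_eq_square)
    finally show ?thesis by (simp add: scaled_lasso_loss_def R2)
  next
    case False
    with dom have "s = 0" "\<forall>i<n. residual p X y b i = 0"
      by (auto simp: scaled_lasso_dom_def)
    then show ?thesis by (simp add: scaled_lasso_loss_def R_def)
  qed
  have "scaled_lasso_loss n p lam X y (\<lambda>_. 0) (N / sqrt (real n)) = N\<^sup>2 / (2 * real n * (N / sqrt (real n))) + N / sqrt (real n) / 2"
    by (simp add: scaled_lasso_loss_def residual_def N2)
  also have "N\<^sup>2 / (2 * real n * (N / sqrt (real n))) = N / sqrt (real n) / 2"
    using N sn by (subst sn(2)[symmetric]) (simp add: field_simps power2_eq_square)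
  finally have zero_loss: "scaled_lasso_loss n p lam X y (\<lambda>_. 0) (N / sqrt (real n)) = N / sqrt (real n)"
    by simp
  have "((\<lambda>_. 0), N / sqrt (real n)) \<in> scaled_lasso_dom n p X y"
    using N sn by (simp add: scaled_lasso_dom_def)
  from min[OF this] lower zero_loss
  have upper: "R / sqrt (real n) + lam * (\<Sum>j<p. \<bar>b j\<bar>) \<le> N / sqrt (real n)" by simp
  have "N\<^sup>2 - (\<Sum>j<p. b j * g j) = (\<Sum>i<n. y i * residual p X y b i)"
  proof -
    have "(\<Sum>j<p. b j * g j) = (\<Sum>i<n. y i * (\<Sum>j<p. X i j * b j))"
      by (simp add: g_def sum_distrib_left sum.swap[of _ "{..<p}" "{..<n}"] mult_ac)
    then show ?thesis
      unfolding N2(1) by (simp add: residual_def right_diff_distrib sum_subtractf power2_eq_square)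
  qed
  also have "\<dots> \<le> (\<Sum>i<n. \<bar>y i\<bar> * \<bar>residual p X y b i\<bar>)"
    by (intro sum_mono) (simp add: abs_mult[symmetric])
  also have "\<dots> \<le> N * R"
    using L2_set_mult_ineq[of y "residual p X y b" "{..<n}"] by (simp add: L2_set_def N_def R_def)
  finally have cs: "N\<^sup>2 - (\<Sum>j<p. b j * g j) \<le> N * R" .
  have "(\<Sum>j<p. b j * g j) < (\<Sum>j<p. \<bar>b j\<bar> * (lam * sqrt (real n) * N))"
  proof (rule sum_strict_mono_ex1)
    show "\<forall>j\<in>{..<p}. b j * g j \<le> \<bar>b j\<bar> * (lam * sqrt (real n) * N)"
    proof
      fix j assume "j \<in> {..<p}"
      then have "\<bar>g j\<bar> \<le> lam * sqrt (real n) * N" using small[of j] by (simp add: g_def N_def)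
      then have "\<bar>b j\<bar> * \<bar>g j\<bar> \<le> \<bar>b j\<bar> * (lam * sqrt (real n) * N)" by (intro mult_left_mono) auto
      then show "b j * g j \<le> \<bar>b j\<bar> * (lam * sqrt (real n) * N)"
        by (simp add: abs_mult[symmetric])
    qed
    have "\<bar>b j\<bar> * \<bar>g j\<bar> < \<bar>b j\<bar> * (lam * sqrt (real n) * N)"
      using nz small[OF j] by (intro mult_strict_left_mono) (auto simp: g_def N_def)
    then have "b j * g j < \<bar>b j\<bar> * (lam * sqrt (real n) * N)"
      using abs_ge_self[of "b j * g j"] by (simp add: abs_mult)
    then show "\<exists>j\<in>{..<p}. b j * g j < \<bar>b j\<bar> * (lam * sqrt (real n) * N)" using j by auto
  qed simp
  also have "\<dots> = N * (sqrt (real n) * (lam * (\<Sum>j<p. \<bar>b j\<bar>)))"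
    by (simp add: sum_distrib_left sum_distrib_right mult_ac)
  finally have "N * N < N * (R + sqrt (real n) * (lam * (\<Sum>j<p. \<bar>b j\<bar>)))"
    using cs by (simp add: power2_eq_square distrib_left)
  then have "N < R + sqrt (real n) * (lam * (\<Sum>j<p. \<bar>b j\<bar>))"
    using N by simp
  also have "\<dots> = sqrt (real n) * (R / sqrt (real n) + lam * (\<Sum>j<p. \<bar>b j\<bar>))"
    using n by (simp add: distrib_left)
  also have "\<dots> \<le> sqrt (real n) * (N / sqrt (real n))"
    using upper sn by (intro mult_left_mono) auto
  also have "\<dots> = N" using n by simp
  finally show False by simp
qed


lemma union_index: "design_index n p \<union> error_index n p = UNIV \<times> {..<n} \<times> {..p}"
  by (auto simp: design_index_def error_index_def)

lemma sum_single_observation: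
  fixes f :: "population \<times> nat \<times> nat \<Rightarrow> real"
  assumes "i < n" and "\<And>m. m \<notin> {k} \<times> {i} \<times> UNIV \<Longrightarrow> f m = 0"
  shows "(\<Sum>m\<in>design_index n p \<union> error_index n p. f m) = (\<Sum>l<p. f (k, i, l)) + f (k, i, p)"
proof -
  have "(\<Sum>m\<in>design_index n p \<union> error_index n p. f m) = (\<Sum>m\<in>{k} \<times> {i} \<times> {..p}. f m)"
    unfolding union_index
    by (rule sum.mono_neutral_right) (use assms in \<open>auto simp del: split_paired_All\<close>)
  also have "\<dots> = (\<Sum>l\<le>p. f (k, i, l))"
    by (rule sum.reindex_bij_witness[of _ "\<lambda>l. (k, i, l)" "\<lambda>m. snd (snd m)"]) auto
  finally show ?thesis by (simp add: lessThan_Suc_atMost[symmetric])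
qed

text \<open>
  The response \<open>y\<^bsub>k,i\<^esub>\<close> under the null hypothesis as a function of the vector of all regressors and errors.
\<close>

definition response :: "nat \<Rightarrow> nat \<Rightarrow> real \<Rightarrow> (population \<times> nat \<times> nat \<Rightarrow> real) \<Rightarrow> population \<Rightarrow> nat \<Rightarrow> real" where
  "response n p c z k i = (\<Sum>l<p. z (k, i, l) * (c / sqrt (real n))) + z (k, i, p)"

text \<open>
  The complement of this event is the hypothesis of \<open>scaled_lasso_zero\<close>.  The responses, divided by their
  standard deviation \<open>sqrt v\<close>, and the entries of column \<open>j\<close> have correlation \<open>\<rho>\<close> with \<open>\<bar>\<rho>\<bar> \<le> \<bar>c\<bar> / sqrt n\<close>.
  On the event that the squared norm of the standardized responses is at most \<open>n L\<close>, the drift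
  caused by the correlation is at most \<open>\<bar>c\<bar> * sqrt L\<close>.
\<close>

lemma large_correlation_bound:
  fixes n p :: nat
  assumes n: "n > 0" and p: "p > 0" and s: "0 \<le> s" and L: "0 < L" and T: "s + \<bar>c\<bar> * sqrt L \<le> T"
  defines "N \<equiv> std_gaussian (design_index n p \<union> error_index n p)"
  shows "measure N {z \<in> space N. \<exists>j<p. T * sqrt (\<Sum>i<n. (response n p c z k i)\<^sup>2) \<le> \<bar>\<Sum>i<n. z (k, i, j) * response n p c z k i\<bar>}
    \<le> 1 / L + real p * (2 * exp (- s\<^sup>2 / 2))"
proof -
  interpret N: prob_space N unfolding N_def by (rule prob_space_std_gaussian)
  define J where "J = design_index n p \<union> error_index n p"
  have I: "finite J" by (simp add: J_def)
  have N_eq: "N = std_gaussian J" by (simp add: N_def J_def)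
  define v where "v = 1 + c\<^sup>2 * real p / real n"
  have v: "v \<ge> 1" using n by (simp add: v_def)
  then have sv: "sqrt v > 0" "(sqrt v)\<^sup>2 = v" by auto
  define \<rho> where "\<rho> = c / sqrt (real n) / sqrt v"
  \<comment> \<open>the coefficients of a standardized response in its own observation\<close>
  define h where "h l = (if l < p then c / sqrt (real n) else 1) / sqrt v" for l
  define b where "b i m = (if fst m = k \<and> fst (snd m) = i then h (snd (snd m)) else 0)" for i and m :: "population \<times> nat \<times> nat"
  define a where "a j i m = (if m = (k, i, j) then 1 else 0 :: real)" for j i and m :: "population \<times> nat \<times> nat"
  have b_sum: "(\<Sum>m\<in>J. b i m * f m) = (\<Sum>l<p. h l * f (k, i, l)) + h p * f (k, i, p)" if "i < n" for i and f :: "_ \<Rightarrow> real"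
    unfolding J_def using that by (subst sum_single_observation[of i n k]) (auto simp: b_def)
  have a_sum: "(\<Sum>m\<in>J. a j i m * f m) = f (k, i, j)" if "i < n" "j < p" for i j and f :: "_ \<Rightarrow> real"
  proof -
    have "(\<Sum>m\<in>J. a j i m * f m) = (\<Sum>m\<in>J. if m = (k, i, j) then f m else 0)"
      by (intro sum.cong) (auto simp: a_def)
    then show ?thesis using that by (simp add: J_def)
  qed
  have response: "(\<Sum>m\<in>J. b i m * z m) = response n p c z k i / sqrt v" if "i < n" for i z
    unfolding b_sum[OF that] by (simp add: response_def h_def add_divide_distrib sum_divide_distrib mult.commute)
  have h_norm: "(\<Sum>l<p. h l * h l) + h p * h p = 1"
  proof -
    have "(\<Sum>l<p. h l * h l) + h p * h p = (real p * (c\<^sup>2 / real n) + 1) / v"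
      using sv n by (simp add: h_def power2_eq_square[symmetric] power_divide power_mult_distrib add_divide_distrib)
    also have "real p * (c\<^sup>2 / real n) + 1 = v" by (simp add: v_def)
    also have "v / v = 1" using v by simp
    finally show ?thesis .
  qed
  have rho: "\<rho>\<^sup>2 < 1"
  proof -
    have "c\<^sup>2 * 1 \<le> c\<^sup>2 * real p" using p by (intro mult_left_mono) auto
    then have "c\<^sup>2 / real n \<le> c\<^sup>2 * real p / real n" using n by (simp add: divide_right_mono)
    then have "c\<^sup>2 / real n < v" by (simp add: v_def)
    then have "c\<^sup>2 < real n * v" using n by (simp add: pos_divide_less_eq mult.commute)
    then show ?thesis using v n by (simp add: \<rho>_def power_divide power_mult_distrib)
  qed
  have rho_le: "\<bar>\<rho>\<bar> * sqrt (real n * L) \<le> \<bar>c\<bar> * sqrt L"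
  proof -
    have "\<bar>\<rho>\<bar> * sqrt (real n * L) = \<bar>c\<bar> * sqrt L / sqrt v"
      using n sv by (simp add: \<rho>_def abs_mult real_sqrt_mult)
    also have "\<dots> \<le> \<bar>c\<bar> * sqrt L / 1"
      using v L by (intro divide_left_mono) auto
    finally show ?thesis by simp
  qed
  have tail: "measure N {z \<in> space N. (s + \<bar>\<rho>\<bar> * sqrt (real n * L)) * sqrt (\<Sum>i<n. (\<Sum>m\<in>J. b i m * z m)\<^sup>2) \<le>
        \<bar>\<Sum>i<n. (\<Sum>m\<in>J. a j i m * z m) * (\<Sum>m\<in>J. b i m * z m)\<bar> \<and> (\<Sum>i<n. (\<Sum>m\<in>J. b i m * z m)\<^sup>2) \<le> real n * L}
      \<le> 2 * exp (- s\<^sup>2 / 2)" if j: "j < p" for j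
    unfolding N_eq
  proof (rule correlated_tail[OF I n s _ rho])
    show "0 < real n * L" using n L by simp
    fix i q assume iq: "i < n" "q < n"
    show "(\<Sum>m\<in>J. a j i m * a j q m) = (if i = q then 1 else 0)"
      using iq j by (simp add: a_sum) (simp add: a_def)
    show "(\<Sum>m\<in>J. b i m * b q m) = (if i = q then 1 else 0)"
      using iq h_norm by (simp add: b_sum) (simp add: b_def)
    show "(\<Sum>m\<in>J. a j i m * b q m) = (if i = q then \<rho> else 0)"
      using iq j by (simp add: a_sum) (simp add: b_def h_def \<rho>_def)
  qed
  let ?B = "\<lambda>j. {z \<in> space N. (s + \<bar>\<rho>\<bar> * sqrt (real n * L)) * sqrt (\<Sum>i<n. (\<Sum>m\<in>J. b i m * z m)\<^sup>2) \<le>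
        \<bar>\<Sum>i<n. (\<Sum>m\<in>J. a j i m * z m) * (\<Sum>m\<in>J. b i m * z m)\<bar> \<and> (\<Sum>i<n. (\<Sum>m\<in>J. b i m * z m)\<^sup>2) \<le> real n * L}"
  let ?C = "{z \<in> space N. real n * L \<le> (\<Sum>i<n. (\<Sum>m\<in>J. b i m * z m)\<^sup>2)}"
  have C: "?C \<in> sets N" unfolding N_eq by measurable
  have B: "?B j \<in> sets N" for j
  proof -
    define q where "q z = (\<Sum>i<n. (\<Sum>m\<in>J. b i m * z m)\<^sup>2)" for z
    define r where "r z = (\<Sum>i<n. (\<Sum>m\<in>J. a j i m * z m) * (\<Sum>m\<in>J. b i m * z m))" for z
    have [measurable]: "q \<in> borel_measurable N" unfolding q_def N_eq by measurable
    have [measurable]: "r \<in> borel_measurable N" unfolding r_def N_eq by measurable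
    have "{z \<in> space N. (s + \<bar>\<rho>\<bar> * sqrt (real n * L)) * sqrt (q z) \<le> \<bar>r z\<bar> \<and> q z \<le> real n * L} \<in> sets N"
      by (intro sets.sets_Collect_conj borel_measurable_le) measurable
    then show ?thesis by (simp only: q_def r_def)
  qed
  have "measure N {z \<in> space N. \<exists>j<p. T * sqrt (\<Sum>i<n. (response n p c z k i)\<^sup>2) \<le> \<bar>\<Sum>i<n. z (k, i, j) * response n p c z k i\<bar>}
      \<le> measure N (?C \<union> (\<Union>j\<in>{..<p}. ?B j))"
  proof (rule N.finite_measure_mono)
    show "{z \<in> space N. \<exists>j<p. T * sqrt (\<Sum>i<n. (response n p c z k i)\<^sup>2) \<le> \<bar>\<Sum>i<n. z (k, i, j) * response n p c z k i\<bar>}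
      \<subseteq> ?C \<union> (\<Union>j\<in>{..<p}. ?B j)"
    proof
      fix z assume "z \<in> {z \<in> space N. \<exists>j<p. T * sqrt (\<Sum>i<n. (response n p c z k i)\<^sup>2) \<le> \<bar>\<Sum>i<n. z (k, i, j) * response n p c z k i\<bar>}"
      then obtain j where z: "z \<in> space N" and j: "j < p"
        and large: "T * sqrt (\<Sum>i<n. (response n p c z k i)\<^sup>2) \<le> \<bar>\<Sum>i<n. z (k, i, j) * response n p c z k i\<bar>"
        by auto
      have norm: "sqrt (\<Sum>i<n. (\<Sum>m\<in>J. b i m * z m)\<^sup>2) = sqrt (\<Sum>i<n. (response n p c z k i)\<^sup>2) / sqrt v"
        by (simp add: response power_divide sum_divide_distrib[symmetric] real_sqrt_divide sv del: real_sqrt_pow2)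
      have inner: "(\<Sum>i<n. (\<Sum>m\<in>J. a j i m * z m) * (\<Sum>m\<in>J. b i m * z m)) = (\<Sum>i<n. z (k, i, j) * response n p c z k i) / sqrt v"
        using j by (simp add: response a_sum sum_divide_distrib)
      have "(s + \<bar>\<rho>\<bar> * sqrt (real n * L)) * sqrt (\<Sum>i<n. (response n p c z k i)\<^sup>2) \<le> T * sqrt (\<Sum>i<n. (response n p c z k i)\<^sup>2)"
        using rho_le T by (intro mult_right_mono) (auto intro: sum_nonneg)
      with large have "(s + \<bar>\<rho>\<bar> * sqrt (real n * L)) * sqrt (\<Sum>i<n. (response n p c z k i)\<^sup>2) \<le> \<bar>\<Sum>i<n. z (k, i, j) * response n p c z k i\<bar>"
        by linarith
      then have "(s + \<bar>\<rho>\<bar> * sqrt (real n * L)) * sqrt (\<Sum>i<n. (response n p c z k i)\<^sup>2) / sqrt v \<le> \<bar>\<Sum>i<n. z (k, i, j) * response n p c z k i\<bar> / sqrt v"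
        using sv by (intro divide_right_mono) auto
      then have "(s + \<bar>\<rho>\<bar> * sqrt (real n * L)) * sqrt (\<Sum>i<n. (\<Sum>m\<in>J. b i m * z m)\<^sup>2) \<le>
        \<bar>\<Sum>i<n. (\<Sum>m\<in>J. a j i m * z m) * (\<Sum>m\<in>J. b i m * z m)\<bar>"
        unfolding norm inner using sv by simp
      then show "z \<in> ?C \<union> (\<Union>j\<in>{..<p}. ?B j)"
        using z j by (cases "(\<Sum>i<n. (\<Sum>m\<in>J. b i m * z m)\<^sup>2) \<le> real n * L") auto
    qed
    show "?C \<union> (\<Union>j\<in>{..<p}. ?B j) \<in> sets N"
      using B C by (intro sets.Un sets.finite_UN) auto
  qed
  also have "\<dots> \<le> measure N ?C + measure N (\<Union>j\<in>{..<p}. ?B j)"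
    using B C by (intro measure_Un_le sets.finite_UN) auto
  also have "\<dots> \<le> 1 / L + (\<Sum>j<p. 2 * exp (- s\<^sup>2 / 2))"
  proof (rule add_mono)
    show "measure N ?C \<le> 1 / L"
      unfolding N_eq
    proof (rule orthonormal_norm_tail[OF I L n])
      fix i assume "i < n"
      then show "(\<Sum>m\<in>J. (b i m)\<^sup>2) = 1"
        using h_norm by (simp add: power2_eq_square b_sum) (simp add: b_def)
    qed
    have "measure N (\<Union>j\<in>{..<p}. ?B j) \<le> (\<Sum>j<p. measure N (?B j))"
      using B by (intro measure_UNION_le) auto
    also have "\<dots> \<le> (\<Sum>j<p. 2 * exp (- s\<^sup>2 / 2))"
      by (intro sum_mono tail) auto
    finally show "measure N (\<Union>j\<in>{..<p}. ?B j) \<le> (\<Sum>j<p. 2 * exp (- s\<^sup>2 / 2))" .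
  qed
  finally show ?thesis by simp
qed

section \<open>The joint law of designs and errors\<close>

text \<open>
  Functions of the two variables with values in a common type are independent in the sense of
  \<open>indep_var\<close>, for which expectations of products factor.
\<close>

lemma indep_rv_imp_indep_var:
  fixes f :: "'a \<Rightarrow> 'c" and g :: "'b \<Rightarrow> 'c"
  assumes "prob_space M" and ind: "indep_rv M S X T Y"
    and f [measurable]: "f \<in> measurable S K" and g [measurable]: "g \<in> measurable T L"
  shows "prob_space.indep_var M K (\<lambda>\<omega>. f (X \<omega>)) L (\<lambda>\<omega>. g (Y \<omega>))"
proof -
  interpret prob_space M by fact
  have X [measurable]: "X \<in> measurable M S" and Y [measurable]: "Y \<in> measurable M T"
    and ind': "indep_set {X -` A \<inter> space M | A. A \<in> sets S} {Y -` B \<inter> space M | B. B \<in> sets T}"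
    using ind by (auto simp: indep_rv_def)
  have sub: "sigma_sets (space M) {(\<lambda>\<omega>. h (Z \<omega>)) -` A \<inter> space M | A. A \<in> sets K'} \<subseteq> {Z -` A \<inter> space M | A. A \<in> sets S'}"
    if Z: "Z \<in> measurable M S'" and h: "h \<in> measurable S' K'" for Z :: "_ \<Rightarrow> 'z" and S' and h :: "'z \<Rightarrow> 'c" and K'
  proof -
    have eq: "sets (vimage_algebra (space M) Z S') = {Z -` A \<inter> space M | A. A \<in> sets S'}"
      using measurable_space[OF Z] by (intro sets_vimage_algebra2) auto
    have "{(\<lambda>\<omega>. h (Z \<omega>)) -` A \<inter> space M | A. A \<in> sets K'} \<subseteq> sets (vimage_algebra (space M) Z S')"
    proof
      fix B assume "B \<in> {(\<lambda>\<omega>. h (Z \<omega>)) -` A \<inter> space M | A. A \<in> sets K'}"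
      then obtain A where A: "A \<in> sets K'" "B = (\<lambda>\<omega>. h (Z \<omega>)) -` A \<inter> space M" by auto
      have "B = Z -` (h -` A \<inter> space S') \<inter> space M"
        using A measurable_space[OF Z] by auto
      moreover have "h -` A \<inter> space S' \<in> sets S'" by (rule measurable_sets[OF h A(1)])
      ultimately show "B \<in> sets (vimage_algebra (space M) Z S')" unfolding eq by blast
    qed
    from sets.sigma_sets_subset[OF this] show ?thesis by (simp add: eq)
  qed
  show ?thesis
    unfolding indep_var_eq
  proof (intro conjI indep_setI)
    show "random_variable K (\<lambda>\<omega>. f (X \<omega>))" "random_variable L (\<lambda>\<omega>. g (Y \<omega>))" by measurable
    show "sigma_sets (space M) {(\<lambda>\<omega>. f (X \<omega>)) -` A \<inter> space M | A. A \<in> sets K} \<subseteq> events"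
      using sub[OF X f] X by (auto intro: measurable_sets)
    show "sigma_sets (space M) {(\<lambda>\<omega>. g (Y \<omega>)) -` A \<inter> space M | A. A \<in> sets L} \<subseteq> events"
      using sub[OF Y g] Y by (auto intro: measurable_sets)
    fix a b
    assume "a \<in> sigma_sets (space M) {(\<lambda>\<omega>. f (X \<omega>)) -` A \<inter> space M | A. A \<in> sets K}"
      "b \<in> sigma_sets (space M) {(\<lambda>\<omega>. g (Y \<omega>)) -` A \<inter> space M | A. A \<in> sets L}"
    then show "prob (a \<inter> b) = prob a * prob b"
      using sub[OF X f] sub[OF Y g] by (intro indep_setD[OF ind']) auto
  qed
qed

definition observations ::
    "nat \<Rightarrow> nat \<Rightarrow> (population \<Rightarrow> nat \<Rightarrow> 'w \<Rightarrow> nat \<Rightarrow> real) \<Rightarrow> (population \<Rightarrow> nat \<Rightarrow> 'w \<Rightarrow> real) \<Rightarrow>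
     'w \<Rightarrow> population \<times> nat \<times> nat \<Rightarrow> real" where
  "observations n p x u \<omega> = (\<lambda>(k, i, j)\<in>design_index n p \<union> error_index n p. if j < p then x k i \<omega> j else u k i \<omega>)"

lemma observations_simps [simp]:
  "i < n \<Longrightarrow> j < p \<Longrightarrow> observations n p x u \<omega> (k, i, j) = x k i \<omega> j"
  "i < n \<Longrightarrow> observations n p x u \<omega> (k, i, p) = u k i \<omega>"
  by (simp_all add: observations_def)

text \<open>
  The characteristic function factors over the observations by their independence, and within an observation
  over the regressors and the error.  Each factor is known, and the product is the characteristic
  function of a standard Gaussian measure.
\<close>

lemma distr_observations:
  fixes x :: "population \<Rightarrow> nat \<Rightarrow> 'w \<Rightarrow> nat \<Rightarrow> real"
  assumes M: "prob_space M"
    and indep_obs: "prob_space.indep_vars M (\<lambda>_. vec_space p \<Otimes>\<^sub>M borel) (\<lambda>(k, i) \<omega>. (x k i \<omega>, u k i \<omega>)) (UNIV \<times> {..<n})"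
    and indep_err: "\<And>k i. i < n \<Longrightarrow> indep_rv M (vec_space p) (x k i) borel (u k i)"
    and x_normal: "\<And>k i. i < n \<Longrightarrow> is_gaussian p (\<lambda>_. 0) (\<lambda>j l. if j = l then 1 else 0) (distr M (vec_space p) (x k i))"
    and u_normal: "\<And>k i. i < n \<Longrightarrow> distributed M lborel (u k i) std_normal_density"
  shows "observations n p x u \<in> measurable M (\<Pi>\<^sub>M m\<in>design_index n p \<union> error_index n p. borel)" (is ?meas)
    and "distr M (\<Pi>\<^sub>M m\<in>design_index n p \<union> error_index n p. borel) (observations n p x u) =
      std_gaussian (design_index n p \<union> error_index n p)" (is ?law)
proof -
  interpret prob_space M by fact
  let ?I = "design_index n p \<union> error_index n p"
  have I: "finite ?I" by simp
  have x [measurable]: "x k i \<in> measurable M (vec_space p)" and u [measurable]: "u k i \<in> borel_measurable M" if "i < n" for k i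
    using indep_err[OF that] by (auto simp: indep_rv_def)
  have xj [measurable]: "(\<lambda>\<omega>. x k i \<omega> j) \<in> borel_measurable M" if "i < n" "j < p" for k i j
    using measurable_compose[OF x[OF that(1)] measurable_component_singleton[of j "{..<p}" "\<lambda>_. borel"]] that(2) by simp
  show meas: ?meas
    unfolding observations_def
  proof (rule measurable_restrict)
    fix m assume "m \<in> ?I"
    then show "(\<lambda>\<omega>. case m of (k, i, j) \<Rightarrow> if j < p then x k i \<omega> j else u k i \<omega>) \<in> borel_measurable M"
      by (cases m) auto
  qed
  show ?law
  proof (rule PiM_char_unique[OF I prob_space_distr[OF meas] prob_space_std_gaussian sets_distr sets_std_gaussian])
    fix a :: "population \<times> nat \<times> nat \<Rightarrow> real"
    define f where "f ki xu = iexp (\<Sum>j<p. a (fst ki, snd ki, j) * fst xu j) * iexp (a (fst ki, snd ki, p) * snd xu)"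
      for ki :: "population \<times> nat" and xu :: "(nat \<Rightarrow> real) \<times> real"
    have f_meas [measurable]: "f ki \<in> borel_measurable (vec_space p \<Otimes>\<^sub>M borel)" for ki
      unfolding f_def by measurable
    have f_expectation: "expectation (\<lambda>\<omega>. f (k, i) (x k i \<omega>, u k i \<omega>)) =
        complex_of_real (exp (- ((\<Sum>j<p. (a (k, i, j))\<^sup>2) + (a (k, i, p))\<^sup>2) / 2))" if i: "i < n" for k i
    proof -
      have "expectation (\<lambda>\<omega>. f (k, i) (x k i \<omega>, u k i \<omega>)) =
          expectation (\<lambda>\<omega>. iexp (\<Sum>j<p. a (k, i, j) * x k i \<omega> j)) * expectation (\<lambda>\<omega>. iexp (a (k, i, p) * u k i \<omega>))"
        unfolding f_def fst_conv snd_conv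
      proof (rule indep_var_lebesgue_integral)
        show "indep_var borel (\<lambda>\<omega>. iexp (\<Sum>j<p. a (k, i, j) * x k i \<omega> j)) borel (\<lambda>\<omega>. iexp (a (k, i, p) * u k i \<omega>))"
          using indep_rv_imp_indep_var[OF M indep_err[OF i],
              of "\<lambda>v. iexp (\<Sum>j<p. a (k, i, j) * v j)" borel "\<lambda>v. iexp (a (k, i, p) * v)" borel k] by simp
        show "integrable M (\<lambda>\<omega>. iexp (\<Sum>j<p. a (k, i, j) * x k i \<omega> j))"
          using i by (intro integrable_iexp) measurable
        show "integrable M (\<lambda>\<omega>. iexp (a (k, i, p) * u k i \<omega>))"
          using i by (intro integrable_iexp) measurable
      qed
      also have "expectation (\<lambda>\<omega>. iexp (\<Sum>j<p. a (k, i, j) * x k i \<omega> j)) =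
          (\<integral>v. iexp (\<Sum>j<p. a (k, i, j) * v j) \<partial>distr M (vec_space p) (x k i))"
        using x[OF i] by (subst integral_distr) auto
      also have "\<dots> = complex_of_real (exp (- (\<Sum>j<p. (a (k, i, j))\<^sup>2) / 2))"
        unfolding char_is_gaussian[OF x_normal[OF i]]
        by (subst char_normal_law) (simp_all add: sum_nonneg if_distrib[of "\<lambda>c. _ * c"] if_distrib[of "\<lambda>c. c * _"] power2_eq_square cong: if_cong)
      also have "expectation (\<lambda>\<omega>. iexp (a (k, i, p) * u k i \<omega>)) = char (distr M lborel (u k i)) (a (k, i, p))"
        unfolding char_def using u[OF i] by (subst integral_distr) auto
      also have "distr M lborel (u k i) = std_normal_distribution"
        using u_normal[OF i] by (simp add: distributed_def)
      also have "char std_normal_distribution (a (k, i, p)) = complex_of_real (exp (- (a (k, i, p))\<^sup>2 / 2))"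
        by (simp add: char_std_normal_distribution)
      finally show ?thesis
        by (simp add: of_real_mult[symmetric] mult_exp_exp add_divide_distrib del: of_real_mult)
    qed
    have sum_I: "(\<Sum>m\<in>?I. h m) = (\<Sum>ki\<in>UNIV \<times> {..<n}. (\<Sum>j<p. h (fst ki, snd ki, j)) + h (fst ki, snd ki, p))" for h :: "_ \<Rightarrow> real"
    proof -
      have "(\<Sum>m\<in>?I. h m) = (\<Sum>kij\<in>(UNIV \<times> {..<n}) \<times> {..p}. h (fst (fst kij), snd (fst kij), snd kij))"
        unfolding union_index
        by (rule sum.reindex_bij_witness[of _ "\<lambda>kij. (fst (fst kij), snd (fst kij), snd kij)" "\<lambda>m. ((fst m, fst (snd m)), snd (snd m))"]) auto
      also have "\<dots> = (\<Sum>ki\<in>UNIV \<times> {..<n}. \<Sum>j\<le>p. h (fst ki, snd ki, j))"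
        by (simp add: sum.cartesian_product split_beta)
      finally show ?thesis by (simp add: lessThan_Suc_atMost[symmetric])
    qed
    have "(\<integral>z. iexp (\<Sum>m\<in>?I. a m * z m) \<partial>distr M (\<Pi>\<^sub>M m\<in>?I. borel) (observations n p x u)) =
        expectation (\<lambda>\<omega>. iexp (\<Sum>m\<in>?I. a m * observations n p x u \<omega> m))"
      using meas by (subst integral_distr) auto
    also have "\<dots> = expectation (\<lambda>\<omega>. \<Prod>ki\<in>UNIV \<times> {..<n}. f ki (case ki of (k, i) \<Rightarrow> (x k i \<omega>, u k i \<omega>)))"
    proof (intro Bochner_Integration.integral_cong refl)
      fix \<omega>
      have "(\<Sum>m\<in>?I. a m * observations n p x u \<omega> m) =
          (\<Sum>ki\<in>UNIV \<times> {..<n}. (\<Sum>j<p. a (fst ki, snd ki, j) * x (fst ki) (snd ki) \<omega> j) + a (fst ki, snd ki, p) * u (fst ki) (snd ki) \<omega>)"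
        unfolding sum_I by (intro sum.cong refl) auto
      moreover have "f ki (case ki of (k, i) \<Rightarrow> (x k i \<omega>, u k i \<omega>)) =
          iexp ((\<Sum>j<p. a (fst ki, snd ki, j) * x (fst ki) (snd ki) \<omega> j) + a (fst ki, snd ki, p) * u (fst ki) (snd ki) \<omega>)" for ki
        by (cases ki) (simp only: f_def prod.case fst_conv snd_conv of_real_add distrib_left exp_add)
      moreover have "iexp (\<Sum>ki\<in>A. g ki) = (\<Prod>ki\<in>A. iexp (g ki))" if "finite A" for A :: "(population \<times> nat) set" and g
        using that by (simp add: sum_distrib_left exp_sum)
      ultimately show "iexp (\<Sum>m\<in>?I. a m * observations n p x u \<omega> m) = (\<Prod>ki\<in>UNIV \<times> {..<n}. f ki (case ki of (k, i) \<Rightarrow> (x k i \<omega>, u k i \<omega>)))"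
        by (simp only:) (simp del: of_real_add of_real_sum)
    qed
    also have "\<dots> = (\<Prod>ki\<in>UNIV \<times> {..<n}. expectation (\<lambda>\<omega>. f ki (case ki of (k, i) \<Rightarrow> (x k i \<omega>, u k i \<omega>))))"
    proof (rule indep_vars_lebesgue_integral)
      show "finite ((UNIV :: population set) \<times> {..<n})" by simp
      have "indep_vars (\<lambda>_. borel) (\<lambda>ki \<omega>. f ki ((case ki of (k, i) \<Rightarrow> \<lambda>\<omega>. (x k i \<omega>, u k i \<omega>)) \<omega>)) (UNIV \<times> {..<n})"
        by (rule indep_vars_compose2[OF indep_obs]) (rule f_meas)
      then show "indep_vars (\<lambda>_. borel) (\<lambda>ki \<omega>. f ki (case ki of (k, i) \<Rightarrow> (x k i \<omega>, u k i \<omega>))) (UNIV \<times> {..<n})"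
        by (simp add: split_beta)
      fix ki assume "ki \<in> (UNIV :: population set) \<times> {..<n}"
      then obtain k i where ki: "ki = (k, i)" "i < n" by auto
      have "(\<lambda>\<omega>. (x k i \<omega>, u k i \<omega>)) \<in> measurable M (vec_space p \<Otimes>\<^sub>M borel)"
        using x[OF ki(2)] u[OF ki(2)] by measurable
      from measurable_compose[OF this f_meas[of ki]]
      show "integrable M (\<lambda>\<omega>. f ki (case ki of (k, i) \<Rightarrow> (x k i \<omega>, u k i \<omega>)))"
        by (intro integrable_const_bound[where B=1]) (auto simp: ki f_def norm_mult)
    qed
    also have "\<dots> = (\<Prod>ki\<in>UNIV \<times> {..<n}. complex_of_real (exp (- ((\<Sum>j<p. (a (fst ki, snd ki, j))\<^sup>2) + (a (fst ki, snd ki, p))\<^sup>2) / 2)))"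
      by (intro prod.cong refl) (auto simp: f_expectation)
    also have "\<dots> = complex_of_real (exp (- (\<Sum>m\<in>?I. (a m)\<^sup>2) / 2))"
    proof -
      have "- (\<Sum>ki\<in>A. g ki) / 2 = (\<Sum>ki\<in>A. - g ki / 2)" for g :: "_ \<Rightarrow> real" and A :: "(population \<times> nat) set"
        by (simp add: sum_divide_distrib sum_negf)
      moreover have "finite ((UNIV :: population set) \<times> {..<n})" by simp
      ultimately show ?thesis
        unfolding sum_I by (simp only: exp_sum of_real_prod)
    qed
    also have "\<dots> = (\<integral>z. iexp (\<Sum>m\<in>?I. a m * z m) \<partial>std_gaussian ?I)"
      by (rule char_std_gaussian[OF I, symmetric])
    finally show "(\<integral>z. iexp (\<Sum>m\<in>?I. a m * z m) \<partial>distr M (\<Pi>\<^sub>M m\<in>?I. borel) (observations n p x u)) =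
        (\<integral>z. iexp (\<Sum>m\<in>?I. a m * z m) \<partial>std_gaussian ?I)" .
  qed
qed

section \<open>The rejection probability\<close>

text \<open>
  The de-biasing step applied to a zero estimate returns \<open>X\<^sup>T y / n\<close>, and under the null hypothesis its signal part is
  the sample covariance matrix times the vector with all entries \<open>c / sqrt n\<close>.
\<close>

lemma test_stat_zero_estimate:
  assumes n: "n > 0"
    and y: "\<And>k i. i < n \<Longrightarrow> y k i = (\<Sum>l<p. X k i l * (c / sqrt (real n))) + e (k, i, p)"
    and b: "\<And>k j. j < p \<Longrightarrow> b k j = 0"
  shows "test_stat n p X y b = zero_fit_stat n p c X e"
  unfolding test_stat_def zero_fit_stat_def
proof (intro arg_cong[where f=Max] image_cong refl)
  fix j assume "j \<in> {..<p}"
  then have j: "j < p" by simp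
  have sn: "sqrt (real n) > 0" "sqrt (real n) * sqrt (real n) = real n" using n by auto
  have scaled: "sqrt (real n) * debiased n p (X k) (y k) (b k) j =
      (\<Sum>l<p. sample_cov n (X k) j l) * c + (\<Sum>i<n. X k i j * e (k, i, p)) / sqrt (real n)" for k
  proof -
    have "debiased n p (X k) (y k) (b k) j = (\<Sum>i<n. X k i j * ((\<Sum>l<p. X k i l * (c / sqrt (real n))) + e (k, i, p))) / real n"
      using j by (simp add: debiased_def residual_def b y)
    also have "(\<Sum>i<n. X k i j * ((\<Sum>l<p. X k i l * (c / sqrt (real n))) + e (k, i, p))) =
        (\<Sum>l<p. \<Sum>i<n. X k i j * X k i l) * (c / sqrt (real n)) + (\<Sum>i<n. X k i j * e (k, i, p))"
      by (simp add: distrib_left sum.distrib sum_distrib_left sum_distrib_right sum_divide_distrib sum.swap[of _ "{..<p}" "{..<n}"] mult.assoc)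
    also have "sqrt (real n) * (\<dots> / real n) =
        (\<Sum>l<p. \<Sum>i<n. X k i j * X k i l) / real n * c + (\<Sum>i<n. X k i j * e (k, i, p)) / sqrt (real n)"
      using sn by (subst (1) sn(2)[symmetric]) (simp add: field_simps)
    finally show ?thesis by (simp add: sample_cov_def sum_divide_distrib)
  qed
  have "sqrt (real n) * \<bar>debiased n p (X PopA) (y PopA) (b PopA) j - debiased n p (X PopB) (y PopB) (b PopB) j\<bar> =
      \<bar>sqrt (real n) * debiased n p (X PopA) (y PopA) (b PopA) j - sqrt (real n) * debiased n p (X PopB) (y PopB) (b PopB) j\<bar>"
    using sn by (simp add: abs_mult right_diff_distrib[symmetric])
  also have "\<dots> = \<bar>(\<Sum>l<p. sample_cov n (X PopA) j l - sample_cov n (X PopB) j l) * c +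
      (\<Sum>m\<in>error_index n p. noise_coef n X j m * e m)\<bar>"
    unfolding scaled
    by (simp add: sum_error_index sum_subtractf left_diff_distrib sum_divide_distrib sum_negf)
  finally show "sqrt (real n) * \<bar>debiased n p (X PopA) (y PopA) (b PopA) j - debiased n p (X PopB) (y PopB) (b PopB) j\<bar> / sqrt (pooled_cov n X j j) =
      \<bar>(\<Sum>l<p. sample_cov n (X PopA) j l - sample_cov n (X PopB) j l) * c +
      (\<Sum>m\<in>error_index n p. noise_coef n X j m * e m)\<bar> / sqrt (pooled_cov n X j j)"
    by simp
qed

lemma measurable_test_stat:
  assumes X: "\<And>k i j. i < n \<Longrightarrow> j < p \<Longrightarrow> (\<lambda>\<omega>. X \<omega> k i j) \<in> borel_measurable M"
    and y [measurable]: "\<And>k i. i < n \<Longrightarrow> (\<lambda>\<omega>. y \<omega> k i) \<in> borel_measurable M"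
    and b [measurable]: "\<And>k j. j < p \<Longrightarrow> (\<lambda>\<omega>. b \<omega> k j) \<in> borel_measurable M"
  shows "(\<lambda>\<omega>. test_stat n p (X \<omega>) (y \<omega>) (b \<omega>)) \<in> borel_measurable M"
proof -
  note [measurable] = X
  have [measurable]: "(\<lambda>\<omega>. debiased n p (X \<omega> k) (y \<omega> k) (b \<omega> k) j) \<in> borel_measurable M" if "j < p" for k j
    unfolding debiased_def residual_def using that by measurable
  have [measurable]: "(\<lambda>\<omega>. sample_cov n (X \<omega> k) j j) \<in> borel_measurable M" if "j < p" for k j
    unfolding sample_cov_def using that by measurable
  show ?thesis
    unfolding test_stat_def by measurable
qed

text \<open>
  Unless a column of one of the designs is strongly correlated with the responses, the test statistic equals the
  statistic for zero estimates, and for the latter the rejection probability is exact.  Hence the error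
  is at most the probability of a strong correlation in one of the two populations.
\<close>

lemma rejection_probability_error:
  fixes x :: "population \<Rightarrow> nat \<Rightarrow> 'w \<Rightarrow> nat \<Rightarrow> real" and y :: "population \<Rightarrow> nat \<Rightarrow> 'w \<Rightarrow> real"
  assumes M: "prob_space M" and n: "n > 0" and p: "p > 0"
    and indep_obs: "prob_space.indep_vars M (\<lambda>_. vec_space p \<Otimes>\<^sub>M borel) (\<lambda>(k, i) \<omega>. (x k i \<omega>, u k i \<omega>)) (UNIV \<times> {..<n})"
    and indep_err: "\<And>k i. i < n \<Longrightarrow> indep_rv M (vec_space p) (x k i) borel (u k i)"
    and x_normal: "\<And>k i. i < n \<Longrightarrow> is_gaussian p (\<lambda>_. 0) (\<lambda>j l. if j = l then 1 else 0) (distr M (vec_space p) (x k i))"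
    and u_normal: "\<And>k i. i < n \<Longrightarrow> distributed M lborel (u k i) std_normal_density"
    and model: "\<And>k i \<omega>. i < n \<Longrightarrow> \<omega> \<in> space M \<Longrightarrow> y k i \<omega> = (\<Sum>j<p. x k i \<omega> j * (c / sqrt (real n))) + u k i \<omega>"
    and b_meas: "\<And>k j. j < p \<Longrightarrow> (\<lambda>\<omega>. b k \<omega> j) \<in> borel_measurable M"
    and lasso: "\<And>k. AE \<omega> in M. is_scaled_lasso n p lam (\<lambda>i j. x k i \<omega> j) (\<lambda>i. y k i \<omega>) (b k \<omega>) (s k \<omega>)"
    and \<alpha>: "0 < \<alpha>" "\<alpha> < 1"
    and t: "0 \<le> t" and L: "0 < L" and lam: "t + \<bar>c\<bar> * sqrt L \<le> lam * sqrt (real n)"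
  defines "X \<equiv> \<lambda>\<omega> k i j. x k i \<omega> j"
  shows "\<bar>measure M {\<omega> \<in> space M. crit_value n p (X \<omega>) \<alpha> < test_stat n p (X \<omega>) (\<lambda>k i. y k i \<omega>) (\<lambda>k. b k \<omega>)} -
      (\<integral>\<omega>. 1 - F_max p (crit_value n p (X \<omega>) \<alpha>) c (sample_cov n (X \<omega> PopA)) (sample_cov n (X \<omega> PopB)) \<partial>M)\<bar>
    \<le> 2 * (1 / L + real p * (2 * exp (- t\<^sup>2 / 2)))"
proof -
  interpret M: prob_space M by fact
  let ?I = "design_index n p \<union> error_index n p"
  let ?N = "std_gaussian ?I"
  interpret N: prob_space ?N by (rule prob_space_std_gaussian)
  let ?Z = "observations n p x u"
  note Z_meas = distr_observations(1)[OF M indep_obs indep_err x_normal u_normal]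
  note Z_law = distr_observations(2)[OF M indep_obs indep_err x_normal u_normal]
  have Z_N [measurable]: "?Z \<in> measurable M ?N"
    using Z_meas by (simp add: measurable_cong_sets[OF refl sets_std_gaussian])
  have law: "distr M ?N ?Z = ?N"
    using Z_law by (simp add: distr_cong[OF refl sets_std_gaussian refl])
  have transfer: "measure M {\<omega> \<in> space M. Q (?Z \<omega>)} = measure ?N {z \<in> space ?N. Q z}"
    if "{z \<in> space ?N. Q z} \<in> sets ?N" for Q
  proof -
    have "measure ?N {z \<in> space ?N. Q z} = measure (distr M ?N ?Z) {z \<in> space ?N. Q z}"
      by (simp only: law)
    also have "\<dots> = measure M (?Z -` {z \<in> space ?N. Q z} \<inter> space M)"
      by (rule measure_distr[OF Z_N that])
    also have "?Z -` {z \<in> space ?N. Q z} \<inter> space M = {\<omega> \<in> space M. Q (?Z \<omega>)}"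
      using measurable_space[OF Z_N] by auto
    finally show ?thesis by simp
  qed
  have coord_N: "(\<lambda>z. z m) \<in> borel_measurable ?N" if "m \<in> ?I" for m
    by (rule measurable_component_singleton[THEN measurable_compose]) (use that in auto)
  have x_meas: "(\<lambda>\<omega>. x k i \<omega> j) \<in> borel_measurable M" if "i < n" "j < p" for k i j
    using measurable_compose[OF Z_N coord_N[of "(k, i, j)"]] that by simp
  have u_meas: "u k i \<in> borel_measurable M" if "i < n" for k i
    using measurable_compose[OF Z_N coord_N[of "(k, i, p)"]] that by simp
  have X_meas: "(\<lambda>\<omega>. X \<omega> k i j) \<in> borel_measurable M" if "i < n" "j < p" for k i j
    unfolding X_def using x_meas that by simp
  have y_meas: "(\<lambda>\<omega>. y k i \<omega>) \<in> borel_measurable M" if "i < n" for k i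
    using x_meas[OF that] u_meas[OF that] by (subst measurable_cong[OF model[OF that]]) auto
  have D_meas: "(\<lambda>z. design z k i j) \<in> borel_measurable ?N" if "i < n" "j < p" for k i j
    unfolding design_def using that by (intro coord_N) auto
  have D_Z: "X \<omega> k i j = design (?Z \<omega>) k i j" if "i < n" "j < p" for \<omega> k i j
    using that by (simp add: X_def design_def)
  have crit_Z: "crit_value n p (X \<omega>) \<alpha> = crit_value n p (design (?Z \<omega>)) \<alpha>" for \<omega>
    by (rule crit_value_cong) (rule D_Z)
  have F_Z: "F_max p v c (sample_cov n (X \<omega> PopA)) (sample_cov n (X \<omega> PopB)) =
      F_max p v c (sample_cov n (design (?Z \<omega>) PopA)) (sample_cov n (design (?Z \<omega>) PopB))" for \<omega> v
    by (rule F_max_design_cong) (rule D_Z)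
  have stat_Z: "zero_fit_stat n p c (X \<omega>) (?Z \<omega>) = zero_fit_stat n p c (design (?Z \<omega>)) (?Z \<omega>)" for \<omega>
    by (rule zero_fit_stat_cong) (simp_all add: D_Z)
  have y_Z: "y k i \<omega> = response n p c (?Z \<omega>) k i" if "i < n" "\<omega> \<in> space M" for k i \<omega>
    using that by (simp add: model response_def)

  \<comment> \<open>\<open>R\<close>: the test rejects; \<open>G\<close>: the statistic for zero estimates exceeds the critical value; \<open>B k\<close>: a column is strongly correlated with the responses\<close>
  define R where "R = {\<omega> \<in> space M. crit_value n p (X \<omega>) \<alpha> < test_stat n p (X \<omega>) (\<lambda>k i. y k i \<omega>) (\<lambda>k. b k \<omega>)}"
  define G where "G = {\<omega> \<in> space M. crit_value n p (X \<omega>) \<alpha> < zero_fit_stat n p c (X \<omega>) (?Z \<omega>)}"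
  define B where "B k = {\<omega> \<in> space M. \<exists>j<p. lam * sqrt (real n) * sqrt (\<Sum>i<n. (y k i \<omega>)\<^sup>2) \<le> \<bar>\<Sum>i<n. x k i \<omega> j * y k i \<omega>\<bar>}" for k
  note [measurable] = measurable_crit_value[OF X_meas p \<alpha>] measurable_test_stat[OF X_meas y_meas b_meas]
  have [measurable]: "(\<lambda>\<omega>. zero_fit_stat n p c (X \<omega>) (?Z \<omega>)) \<in> borel_measurable M"
    by (rule measurable_zero_fit_stat) (use X_meas measurable_compose[OF Z_N coord_N] in auto)
  have R [measurable]: "R \<in> sets M" unfolding R_def by measurable
  have G [measurable]: "G \<in> sets M" unfolding G_def by measurable
  have B [measurable]: "B k \<in> sets M" for k
  proof -
    note [measurable] = x_meas y_meas
    have "{\<omega> \<in> space M. \<exists>j\<in>{..<p}. lam * sqrt (real n) * sqrt (\<Sum>i<n. (y k i \<omega>)\<^sup>2) \<le> \<bar>\<Sum>i<n. x k i \<omega> j * y k i \<omega>\<bar>} \<in> sets M"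
      by measurable
    then show ?thesis by (simp only: B_def Bex_def lessThan_iff)
  qed

  have prob_G: "measure M G = (\<integral>\<omega>. 1 - F_max p (crit_value n p (X \<omega>) \<alpha>) c (sample_cov n (X \<omega> PopA)) (sample_cov n (X \<omega> PopB)) \<partial>M)"
  proof -
    note [measurable] = measurable_crit_value[OF D_meas p \<alpha>] measurable_zero_fit_stat[OF D_meas coord_N]
      measurable_F_max_design[OF D_meas measurable_crit_value[OF D_meas p \<alpha>]]
    let ?f = "\<lambda>z. 1 - F_max p (crit_value n p (design z) \<alpha>) c (sample_cov n (design z PopA)) (sample_cov n (design z PopB))"
    have "measure M G = measure ?N {z \<in> space ?N. crit_value n p (design z) \<alpha> < zero_fit_stat n p c (design z) z}"
      unfolding G_def crit_Z stat_Z by (rule transfer) measurable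
    also have "\<dots> = (\<integral>z. ?f z \<partial>distr M ?N ?Z)"
      unfolding law by (rule rejection_probability_zero_fit[OF p \<alpha>])
    also have "\<dots> = (\<integral>\<omega>. ?f (?Z \<omega>) \<partial>M)"
      by (rule integral_distr) measurable
    finally show ?thesis by (simp add: crit_Z F_Z)
  qed
  have prob_B: "measure M (B k) \<le> 1 / L + real p * (2 * exp (- t\<^sup>2 / 2))" for k
  proof -
    let ?Q = "\<lambda>z. \<exists>j<p. lam * sqrt (real n) * sqrt (\<Sum>i<n. (response n p c z k i)\<^sup>2) \<le> \<bar>\<Sum>i<n. z (k, i, j) * response n p c z k i\<bar>"
    have "{z \<in> space ?N. \<exists>j\<in>{..<p}. lam * sqrt (real n) * sqrt (\<Sum>i<n. (response n p c z k i)\<^sup>2) \<le> \<bar>\<Sum>i<n. z (k, i, j) * response n p c z k i\<bar>} \<in> sets ?N"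
    proof -
      have [measurable]: "(\<lambda>z. z (k, i, j)) \<in> borel_measurable ?N" if "i < n" "j < p" for i j
        using that by (intro coord_N) auto
      have [measurable]: "(\<lambda>z. z (k, i, p)) \<in> borel_measurable ?N" if "i < n" for i
        using that by (intro coord_N) auto
      have [measurable]: "(\<lambda>z. response n p c z k i) \<in> borel_measurable ?N" if "i < n" for i
        unfolding response_def using that by measurable
      have "(\<lambda>z. lam * sqrt (real n) * sqrt (\<Sum>i<n. (response n p c z k i)\<^sup>2)) \<in> borel_measurable ?N"
        by measurable
      moreover have "(\<lambda>z. \<bar>\<Sum>i<n. z (k, i, j) * response n p c z k i\<bar>) \<in> borel_measurable ?N" if "j < p" for j
        using that by measurable
      ultimately show ?thesis
        by (intro sets.sets_Collect_finite_Ex borel_measurable_le) auto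
    qed
    then have Q: "{z \<in> space ?N. ?Q z} \<in> sets ?N" by (simp only: Bex_def lessThan_iff)
    have "B k = {\<omega> \<in> space M. ?Q (?Z \<omega>)}"
      unfolding B_def by (simp add: y_Z cong: conj_cong)
    then show ?thesis
      using large_correlation_bound[OF n p t L lam, of k] by (simp only: transfer[OF Q])
  qed
  have agree: "AE \<omega> in M. \<omega> \<notin> B PopA \<union> B PopB \<longrightarrow> (\<omega> \<in> R \<longleftrightarrow> \<omega> \<in> G)"
    using lasso[of PopA] lasso[of PopB] AE_space
  proof eventually_elim
    case (elim \<omega>)
    show ?case
    proof
      assume good: "\<omega> \<notin> B PopA \<union> B PopB"
      have zero: "b k \<omega> j = 0" if "j < p" for k j
      proof (rule scaled_lasso_zero[OF n _ _ that])
        show "is_scaled_lasso n p lam (\<lambda>i j. x k i \<omega> j) (\<lambda>i. y k i \<omega>) (b k \<omega>) (s k \<omega>)"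
          using elim by (cases k) auto
        fix j assume "j < p"
        moreover have "\<omega> \<notin> B k" using good by (cases k) auto
        ultimately show "\<bar>\<Sum>i<n. x k i \<omega> j * y k i \<omega>\<bar> < lam * sqrt (real n) * sqrt (\<Sum>i<n. (y k i \<omega>)\<^sup>2)"
          using elim by (auto simp: B_def not_le)
      qed
      have "test_stat n p (X \<omega>) (\<lambda>k i. y k i \<omega>) (\<lambda>k. b k \<omega>) = zero_fit_stat n p c (X \<omega>) (?Z \<omega>)"
        using elim zero by (intro test_stat_zero_estimate[OF n]) (simp_all add: model X_def)
      then show "\<omega> \<in> R \<longleftrightarrow> \<omega> \<in> G" by (simp add: R_def G_def)
    qed
  qed
  have RG: "measure M R \<le> measure M (G \<union> (B PopA \<union> B PopB))"
    using agree by (intro M.finite_measure_mono_AE) auto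
  have GR: "measure M G \<le> measure M (R \<union> (B PopA \<union> B PopB))"
    using agree by (intro M.finite_measure_mono_AE) auto
  have union: "measure M (E \<union> (B PopA \<union> B PopB)) \<le> measure M E + (measure M (B PopA) + measure M (B PopB))" if "E \<in> sets M" for E
    using measure_Un_le[OF that, of "B PopA \<union> B PopB"] measure_Un_le[OF B B, of PopA PopB] B by fastforce
  have "\<bar>measure M R - measure M G\<bar> \<le> measure M (B PopA) + measure M (B PopB)"
    using RG GR union[OF R] union[OF G] by linarith
  also have "\<dots> \<le> 2 * (1 / L + real p * (2 * exp (- t\<^sup>2 / 2)))"
    using prob_B[of PopA] prob_B[of PopB] by simp
  finally show ?thesis
    unfolding prob_G R_def .
qed

theorem lemma1:
  fixes P :: "nat \<Rightarrow> 'w measure"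
    and p :: "nat \<Rightarrow> nat"
    and x :: "nat \<Rightarrow> population \<Rightarrow> nat \<Rightarrow> 'w \<Rightarrow> nat \<Rightarrow> real"
    and u y :: "nat \<Rightarrow> population \<Rightarrow> nat \<Rightarrow> 'w \<Rightarrow> real"
    and beta :: "nat \<Rightarrow> population \<Rightarrow> nat \<Rightarrow> real"
    and beta_hat :: "nat \<Rightarrow> population \<Rightarrow> 'w \<Rightarrow> nat \<Rightarrow> real"
    and sigma_hat :: "nat \<Rightarrow> population \<Rightarrow> 'w \<Rightarrow> real"
    and c \<alpha> lam0 :: real
  defines "X \<equiv> \<lambda>n \<omega> k i j. x n k i \<omega> j"
    and "Y \<equiv> \<lambda>n \<omega> k i. y n k i \<omega>"
  assumes prob: "\<And>n. prob_space (P n)"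
    and dim: "filterlim (\<lambda>n. real (p n) / real n) at_top sequentially"
    and indep_obs: "\<And>n. prob_space.indep_vars (P n)
          (\<lambda>_. vec_space (p n) \<Otimes>\<^sub>M borel)
          (\<lambda>(k, i) \<omega>. (x n k i \<omega>, u n k i \<omega>)) (UNIV \<times> {..<n})"
    and indep_err: "\<And>n k i. i < n \<Longrightarrow>
          indep_rv (P n) (vec_space (p n)) (x n k i) borel (u n k i)"
    and x_normal: "\<And>n k i. i < n \<Longrightarrow>
          is_gaussian (p n) (\<lambda>_. 0) (\<lambda>j l. if j = l then 1 else 0)
            (distr (P n) (vec_space (p n)) (x n k i))"
    and u_normal: "\<And>n k i. i < n \<Longrightarrow>
          distributed (P n) lborel (u n k i) std_normal_density"
    and model: "\<And>n k i \<omega>. i < n \<Longrightarrow> \<omega> \<in> space (P n) \<Longrightarrow>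
          y n k i \<omega> = (\<Sum>j<p n. x n k i \<omega> j * beta n k j) + u n k i \<omega>"
    and null: "\<And>n k j. j < p n \<Longrightarrow> beta n k j = c / sqrt (real n)"
    and lam0: "lam0 > sqrt 2"
    and beta_hat_measurable: "\<And>n k j. j < p n \<Longrightarrow>
          (\<lambda>\<omega>. beta_hat n k \<omega> j) \<in> borel_measurable (P n)"
    and scaled_lasso: "\<And>n k. AE \<omega> in P n.
          is_scaled_lasso n (p n) (lam0 * sqrt (ln (real (p n)) / real n))
            (X n \<omega> k) (Y n \<omega> k) (beta_hat n k \<omega>) (sigma_hat n k \<omega>)"
    and alpha: "0 < \<alpha>" "\<alpha> < 1"
  shows "(\<lambda>n.
      \<P>(\<omega> in P n. test_stat n (p n) (X n \<omega>) (Y n \<omega>) (\<lambda>k. beta_hat n k \<omega>)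
                    > crit_value n (p n) (X n \<omega>) \<alpha>)
      - (\<integral>\<omega>. 1 - F_max (p n) (crit_value n (p n) (X n \<omega>) \<alpha>) c
                    (sample_cov n (X n \<omega> PopA)) (sample_cov n (X n \<omega> PopB)) \<partial>P n))
    \<longlonglongrightarrow> 0"
proof (rule Lim_null_comparison)
  define l where "l n = ln (real (p n))" for n
  \<comment> \<open>\<open>rejection_probability_error\<close> is applied with \<open>L = sqrt (ln p)\<close>: this tends to infinity, which controls the norm of the responses, yet the drift \<open>\<bar>c\<bar> * sqrt L\<close> is negligible against \<open>sqrt (ln p)\<close>\<close>
  define t where "t n = lam0 * sqrt (l n) - \<bar>c\<bar> * sqrt (sqrt (l n))" for n
  have p_large: "filterlim (\<lambda>n. real (p n)) at_top sequentially"
  proof (rule filterlim_at_top_mono[OF dim])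
    show "\<forall>\<^sub>F n in sequentially. real (p n) / real n \<le> real (p n)"
      using eventually_gt_at_top[of 0]
    proof eventually_elim
      case (elim n)
      then show ?case by (simp add: pos_divide_le_eq mult_le_cancel_left1)
    qed
  qed
  have l_large: "filterlim l at_top sequentially"
    unfolding l_def by (rule filterlim_compose[OF ln_at_top p_large])
  have sqrt_l_large: "filterlim (\<lambda>n. sqrt (l n)) at_top sequentially"
    by (rule filterlim_compose[OF sqrt_at_top l_large])
  have "(\<lambda>n. 1 / sqrt (l n)) \<longlonglongrightarrow> 0"
    by (rule tendsto_divide_0[OF tendsto_const filterlim_at_top_imp_at_infinity[OF sqrt_l_large]])
  moreover have "(\<lambda>n. exp (l n) * exp (- (t n)\<^sup>2 / 2)) \<longlonglongrightarrow> 0"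
    unfolding t_def by (rule filterlim_compose[OF gaussian_union_bound_asymptotics[OF lam0] l_large])
  ultimately have "(\<lambda>n. 2 * (1 / sqrt (l n) + 2 * (exp (l n) * exp (- (t n)\<^sup>2 / 2)))) \<longlonglongrightarrow> 2 * (0 + 2 * 0)"
    by (intro tendsto_intros)
  then show "(\<lambda>n. 2 * (1 / sqrt (l n) + 2 * (exp (l n) * exp (- (t n)\<^sup>2 / 2)))) \<longlonglongrightarrow> 0"
    by simp
  have "\<forall>\<^sub>F n in sequentially. \<bar>c\<bar> \<le> sqrt (sqrt (l n))"
    using filterlim_compose[OF sqrt_at_top sqrt_l_large] by (simp add: filterlim_at_top)
  moreover have "\<forall>\<^sub>F n in sequentially. 0 < l n"
    using l_large by (simp add: filterlim_at_top_dense)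
  moreover have "\<forall>\<^sub>F n in sequentially. 0 < real (p n)"
    using p_large unfolding filterlim_at_top_dense by blast
  ultimately show "\<forall>\<^sub>F n in sequentially. norm (
      \<P>(\<omega> in P n. test_stat n (p n) (X n \<omega>) (Y n \<omega>) (\<lambda>k. beta_hat n k \<omega>) > crit_value n (p n) (X n \<omega>) \<alpha>)
      - (\<integral>\<omega>. 1 - F_max (p n) (crit_value n (p n) (X n \<omega>) \<alpha>) c
                    (sample_cov n (X n \<omega> PopA)) (sample_cov n (X n \<omega> PopB)) \<partial>P n))
      \<le> 2 * (1 / sqrt (l n) + 2 * (exp (l n) * exp (- (t n)\<^sup>2 / 2)))"
    using eventually_gt_at_top[of 0]
  proof eventually_elim
    case (elim n)
    have "1 \<le> lam0" using lam0 real_sqrt_ge_1_iff[of 2] by linarith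
    have "\<bar>c\<bar> * sqrt (sqrt (l n)) \<le> sqrt (sqrt (l n)) * sqrt (sqrt (l n))"
      using elim by (intro mult_right_mono) auto
    also have "\<dots> = 1 * sqrt (l n)" using elim by simp
    also have "\<dots> \<le> lam0 * sqrt (l n)"
      using \<open>1 \<le> lam0\<close> elim by (intro mult_right_mono) auto
    finally have t: "0 \<le> t n" by (simp add: t_def)
    have pn: "p n > 0" using elim by simp
    have lam: "t n + \<bar>c\<bar> * sqrt (sqrt (l n)) \<le> lam0 * sqrt (ln (real (p n)) / real n) * sqrt (real n)"
      using elim by (simp add: t_def l_def real_sqrt_divide)
    have model': "y n k i \<omega> = (\<Sum>j<p n. x n k i \<omega> j * (c / sqrt (real n))) + u n k i \<omega>"
      if "i < n" "\<omega> \<in> space (P n)" for k i \<omega>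
      using model[OF that] null by simp
    have sq: "0 < sqrt (l n)" using elim by simp
    have "exp (l n) = real (p n)" using pn by (simp add: l_def)
    then show ?case
      using rejection_probability_error[of "P n" n "p n" "x n" "u n" "y n" c "beta_hat n"
          "lam0 * sqrt (ln (real (p n)) / real n)" "sigma_hat n" \<alpha> "t n" "sqrt (l n)",
          OF prob _ pn indep_obs indep_err x_normal u_normal model' beta_hat_measurable
            scaled_lasso[unfolded X_def Y_def] alpha t sq lam] elim
      by (simp add: X_def Y_def mult.left_commute)
  qed
qed

end
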